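(* Let $\mu>1$ and $r>0$, let $S_{\mu,r}$ be the pseudospherical helicoid (of magnetic type) with parameters $(\mu,r)$, and put $m=\mu^{-1}\in(0,1)$. Define $$\psi(u)=\sqrt{m+\sinh^2 r}\,\coth(r)\Big(\Pi(-m\,\mathrm{csch}^2 r,m)-\Pi(-m\,\mathrm{csch}^2 r,\mathrm{am}(u,m),m)\Big),$$ $$\xi(u)=\mathrm{dn}(u,m)\,\mathrm{sn}^2(u,m)\sqrt{m\,\mathrm{sn}^2(u,m)+\sinh^2 r},$$ $$\zeta(u)=\frac{1}{\sqrt{m+\sinh^2 r}}\Big(E(m)+\cosh^2(r)\,(u-K(m))-E(\mathrm{am}(u,m),m)\Big),$$ $$q^1(u)=\frac{-\sqrt m}{\sqrt{m+\sinh^2 r}\;\mathrm{sn}(u,m)\big(m\,\mathrm{sn}^2(u,m)+\sinh^2 r\big)},$$ $$q^2(u)=\frac{\sqrt m\,\cosh(r)\sinh(r)\,\mathrm{cn}(u,m)}{(m+\sinh^2 r)\,\mathrm{sn}^2(u,m)\,\mathrm{dn}(u,m)\big(m\,\mathrm{sn}^2(u,m)+\sinh^2 r\big)},\qquad \rho=-2\pi\frac{\cosh(r)\sinh(r)}{m+\sinh^2 r},$$ and $$\widetilde x=\xi\big(\cos(\psi)q^1-\sin(\psi)q^2\big),\qquad \widetilde y=\xi\big(\sin(\psi)q^1+\cos(\psi)q^2\big),\qquad \widetilde z=\zeta .$$ Then the real analytic map $\widetilde f:\mathbb{R}^2\to\mathbb{R}^3$, $$\widetilde f(u,v)=\big(\cos(2\pi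 v)\widetilde x(u)-\sin(2\pi v)\widetilde y(u),\ \sin(2\pi v)\widetilde x(u)+\cos(2\pi v)\widetilde y(u),\ \widetilde z(u)+\rho v\big),$$ is a global parametrization of $-S_{\mu,r}=\{-\mathbf{x}:\mathbf{x}\in S_{\mu,r}\}$.
   Context: Elliptic functions and integrals (parameter $m=k^2$). $F(\varphi,m)=\int_0^\varphi(1-m\sin^2\theta)^{-1/2}d\theta$, $E(\varphi,m)=\int_0^\varphi(1-m\sin^2\theta)^{1/2}d\theta$, $\Pi(n,\varphi,m)=\int_0^\varphi\frac{d\theta}{(1-n\sin^2\theta)(1-m\sin^2\theta)^{1/2}}$; complete integrals: $K(m)=F(\pi/2,m)$, $E(m)=E(\pi/2,m)$, $\Pi(n,m)=\Pi(n,\pi/2,m)$. For any real $\mu$, $\mathrm{am}(\cdot,\mu):\mathbb{R}\to\mathbb{R}$ is the Jacobian amplitude, i.e. the solution of $\theta''=-\mu\sin\theta\cos\theta$, $\theta(0)=0$, $\theta'(0)=1$ (near $0$, the inverse of $F(\cdot,\mu)$), and $\mathrm{sn}=\sin\mathrm{am}$, $\mathrm{cn}=\cos\mathrm{am}$, $\mathrm{dn}=\mathrm{am}'$ (so $\mathrm{dn}^2=1-\mu\,\mathrm{sn}^2$). The products $\xi q^1$ and $\xi q^2$ are understood to be extended analytically across the zeros of $\mathrm{sn}(u,m)$. Pseudospherical helicoids. Let $\phi:\mathbb{R}^2\to\mathbb{R}$ be a smooth nonconstant solution of the sine-Gordon equation $\phi_{ss}-\phi_{tt}=\sin\phi$.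 There is a smooth map $f_\phi:\mathbb{R}^2\to\mathbb{R}^3$, unique up to orientation-preserving rigid motions, which on the open set where $\phi\notin\pi\mathbb{Z}$ is an immersion of Gauss curvature $-1$ with first and second fundamental forms $\cos^2(\phi/2)ds^2+\sin^2(\phi/2)dt^2$ and $\cos(\phi/2)\sin(\phi/2)(ds^2-dt^2)$; precisely, there is a smooth positively oriented orthonormal frame $(e_1,e_2,e_3)$ along $f_\phi$ with $\partial_s f_\phi=\cos(\phi/2)e_1$, $\partial_t f_\phi=\sin(\phi/2)e_2$, and the second fundamental form is $-\langle df_\phi,de_3\rangle$. For $\mu>0$, $\mu\neq1$ and $r>0$ put $\phi_{\mu,r}(s,t)=-2\,\mathrm{am}\big(\tfrac{\sinh r}{\sqrt{\mu}}s+\tfrac{\cosh r}{\sqrt{\mu}}t,\mu\big)$, a solution of the sine-Gordon equation. The pseudospherical helicoid with parameters $(\mu,r)$ is the image $S_{\mu,r}=f_{\phi_{\mu,r}}(\mathbb{R}^2)$; it is defined up to orientation-preserving rigid motions. A global parametrization of a surface $S$ is a map defined on all of $\mathbb{R}^2$ whose image is $S$; equality of surfaces is understood up to orientation-preserving rigid motions. *)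

theory Defs
  imports "HOL-Analysis.Analysis"
begin

section \<open>Smooth and real analytic maps\<close>

primrec Ck :: "nat \<Rightarrow> ('a::euclidean_space \<Rightarrow> 'b::real_normed_vector) \<Rightarrow> bool" where
  "Ck 0 f \<longleftrightarrow> continuous_on UNIV f"
| "Ck (Suc k) f \<longleftrightarrow> (\<forall>p. f differentiable (at p)) \<and>
     (\<forall>w. Ck k (\<lambda>p. frechet_derivative f (at p) w))"

definition smooth_map :: "('a::euclidean_space \<Rightarrow> 'b::real_normed_vector) \<Rightarrow> bool" where
  "smooth_map f \<longleftrightarrow> (\<forall>k. Ck k f)"

definition real_analytic :: "(real \<Rightarrow> real) \<Rightarrow> bool" where
  "real_analytic h \<longleftrightarrow> (\<forall>x0. \<exists>\<epsilon>>0. \<exists>c. \<forall>x. \<bar>x - x0\<bar> < \<epsilon> \<longrightarrow>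
     (\<lambda>n. c n * (x - x0) ^ n) sums h x)"

text \<open>In two variables, double power series are summed unconditionally.\<close>

definition real_analytic2 :: "(real \<times> real \<Rightarrow> 'b::real_normed_vector) \<Rightarrow> bool" where
  "real_analytic2 f \<longleftrightarrow> (\<forall>x0 y0. \<exists>\<epsilon>>0. \<exists>c. \<forall>x y. \<bar>x - x0\<bar> < \<epsilon> \<and> \<bar>y - y0\<bar> < \<epsilon> \<longrightarrow>
     ((\<lambda>(i, j). ((x - x0) ^ i * (y - y0) ^ j) *\<^sub>R c i j) has_sum f (x, y))
       (UNIV :: (nat \<times> nat) set))"

text \<open>The real analytic function on the whole line that agrees with \<open>g\<close> on \<open>A\<close>. It is unique when
  \<open>A\<close> has an accumulation point, in particular when the complement of \<open>A\<close> is discrete. The values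
  of \<open>g\<close> outside \<open>A\<close> (where \<open>g\<close> may contain a division by zero) play no role.\<close>

definition analytic_extension :: "real set \<Rightarrow> (real \<Rightarrow> real) \<Rightarrow> real \<Rightarrow> real" where
  "analytic_extension A g = (THE h. real_analytic h \<and> (\<forall>u\<in>A. h u = g u))"


section \<open>Elliptic integrals and Jacobi elliptic functions\<close>

text \<open>The second argument is the parameter \<open>m = k\<^sup>2\<close>, not the modulus \<open>k\<close>.
  The integrals are oriented, so negative amplitudes are covered.\<close>

definition ellF :: "real \<Rightarrow> real \<Rightarrow> real" where
  "ellF \<phi> m = (LBINT \<theta>=0..\<phi>. 1 / sqrt (1 - m * (sin \<theta>)\<^sup>2))"

definition ellE :: "real \<Rightarrow> real \<Rightarrow> real" where
  "ellE \<phi> m = (LBINT \<theta>=0..\<phi>. sqrt (1 - m * (sin \<theta>)\<^sup>2))"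

definition ellPi :: "real \<Rightarrow> real \<Rightarrow> real \<Rightarrow> real" where
  "ellPi n \<phi> m = (LBINT \<theta>=0..\<phi>. 1 / ((1 - n * (sin \<theta>)\<^sup>2) * sqrt (1 - m * (sin \<theta>)\<^sup>2)))"

definition complete_K :: "real \<Rightarrow> real" where
  "complete_K m = ellF (pi / 2) m"

definition complete_E :: "real \<Rightarrow> real" where
  "complete_E m = ellE (pi / 2) m"

definition complete_Pi :: "real \<Rightarrow> real \<Rightarrow> real" where
  "complete_Pi n m = ellPi n (pi / 2) m"

definition is_amplitude :: "real \<Rightarrow> (real \<Rightarrow> real) \<Rightarrow> bool" where
  "is_amplitude \<mu> \<theta> \<longleftrightarrow> (\<exists>\<omega>.
     (\<forall>x. (\<theta> has_real_derivative \<omega> x) (at x)) \<and>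
     (\<forall>x. (\<omega> has_real_derivative (- \<mu> * sin (\<theta> x) * cos (\<theta> x))) (at x)) \<and>
     \<theta> 0 = 0 \<and> \<omega> 0 = 1)"

definition am :: "real \<Rightarrow> real \<Rightarrow> real" where
  "am x \<mu> = (THE \<theta>. is_amplitude \<mu> \<theta>) x"

definition sn :: "real \<Rightarrow> real \<Rightarrow> real" where
  "sn x \<mu> = sin (am x \<mu>)"

definition cn :: "real \<Rightarrow> real \<Rightarrow> real" where
  "cn x \<mu> = cos (am x \<mu>)"

definition dn :: "real \<Rightarrow> real \<Rightarrow> real" where
  "dn x \<mu> = deriv (\<lambda>y. am y \<mu>) x"


section \<open>Surfaces up to orientation-preserving rigid motions\<close>

definition rigid_motion :: "(real^3 \<Rightarrow> real^3) \<Rightarrow> bool" where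
  "rigid_motion T \<longleftrightarrow> (\<exists>A b. rotation_matrix A \<and> T = (\<lambda>x. A *v x + b))"

definition same_surface :: "(real^3) set \<Rightarrow> (real^3) set \<Rightarrow> bool" where
  "same_surface S S' \<longleftrightarrow> (\<exists>T. rigid_motion T \<and> T ` S = S')"

definition global_parametrization :: "(real \<times> real \<Rightarrow> real^3) \<Rightarrow> (real^3) set \<Rightarrow> bool" where
  "global_parametrization f S \<longleftrightarrow> same_surface (range f) S"


section \<open>Pseudospherical surfaces and helicoids\<close>

definition positive_orthonormal :: "real^3 \<Rightarrow> real^3 \<Rightarrow> real^3 \<Rightarrow> bool" where
  "positive_orthonormal a b c \<longleftrightarrow>
     norm a = 1 \<and> norm b = 1 \<and> norm c = 1 \<and> a \<bullet> b = 0 \<and> a \<bullet> c = 0 \<and> b \<bullet> c = 0 \<and>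
     det (vector [a, b, c] :: real^3^3) > 0"

text \<open>The relation between a sine-Gordon solution \<open>\<phi>\<close> and a map \<open>f\<^sub>\<phi>\<close>. Orthonormality of the frame
  gives the first fundamental form \<open>cos\<^sup>2(\<phi>/2) ds\<^sup>2 + sin\<^sup>2(\<phi>/2) dt\<^sup>2\<close>, so \<open>f\<close> is an immersion where
  \<open>\<phi>\<close> is not in \<open>\<pi>\<int>\<close>. The last conjunct says that the second fundamental form \<open>- \<langle>df, de\<^sub>3\<rangle>\<close> is
  \<open>cos(\<phi>/2) sin(\<phi>/2) (ds\<^sup>2 - dt\<^sup>2)\<close>, as a bilinear form in the tangent vectors \<open>v\<close>, \<open>w\<close>.\<close>

definition pseudospherical_map ::
    "(real \<times> real \<Rightarrow> real) \<Rightarrow> (real \<times> real \<Rightarrow> real^3) \<Rightarrow> bool" where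
  "pseudospherical_map \<phi> f \<longleftrightarrow> smooth_map f \<and>
     (\<exists>e1 e2 e3. smooth_map e1 \<and> smooth_map e2 \<and> smooth_map e3 \<and>
       (\<forall>p. positive_orthonormal (e1 p) (e2 p) (e3 p) \<and>
          frechet_derivative f (at p) (1, 0) = cos (\<phi> p / 2) *\<^sub>R e1 p \<and>
          frechet_derivative f (at p) (0, 1) = sin (\<phi> p / 2) *\<^sub>R e2 p \<and>
          (\<forall>v w. - (frechet_derivative f (at p) v \<bullet> frechet_derivative e3 (at p) w) =
             cos (\<phi> p / 2) * sin (\<phi> p / 2) * (fst v * fst w - snd v * snd w))))"

definition helicoid_angle :: "real \<Rightarrow> real \<Rightarrow> real \<times> real \<Rightarrow> real" where
  "helicoid_angle \<mu> r = (\<lambda>(s, t). - 2 * am (sinh r / sqrt \<mu> * s + cosh r / sqrt \<mu> * t) \<mu>)"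

text \<open>A predicate rather than a set, because the surface is only defined up to
  orientation-preserving rigid motions.\<close>

definition pseudospherical_helicoid :: "real \<Rightarrow> real \<Rightarrow> (real^3) set \<Rightarrow> bool" where
  "pseudospherical_helicoid \<mu> r S \<longleftrightarrow>
     (\<exists>f. pseudospherical_map (helicoid_angle \<mu> r) f \<and> S = range f)"


section \<open>The explicit parametrization\<close>

definition psi :: "real \<Rightarrow> real \<Rightarrow> real \<Rightarrow> real" where
  "psi m r u = sqrt (m + (sinh r)\<^sup>2) * (cosh r / sinh r) *
     (complete_Pi (- m / (sinh r)\<^sup>2) m - ellPi (- m / (sinh r)\<^sup>2) (am u m) m)"

definition xi :: "real \<Rightarrow> real \<Rightarrow> real \<Rightarrow> real" where
  "xi m r u = dn u m * (sn u m)\<^sup>2 * sqrt (m * (sn u m)\<^sup>2 + (sinh r)\<^sup>2)"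

definition zeta :: "real \<Rightarrow> real \<Rightarrow> real \<Rightarrow> real" where
  "zeta m r u = 1 / sqrt (m + (sinh r)\<^sup>2) *
     (complete_E m + (cosh r)\<^sup>2 * (u - complete_K m) - ellE (am u m) m)"

definition q1 :: "real \<Rightarrow> real \<Rightarrow> real \<Rightarrow> real" where
  "q1 m r u = - sqrt m /
     (sqrt (m + (sinh r)\<^sup>2) * sn u m * (m * (sn u m)\<^sup>2 + (sinh r)\<^sup>2))"

definition q2 :: "real \<Rightarrow> real \<Rightarrow> real \<Rightarrow> real" where
  "q2 m r u = sqrt m * cosh r * sinh r * cn u m /
     ((m + (sinh r)\<^sup>2) * (sn u m)\<^sup>2 * dn u m * (m * (sn u m)\<^sup>2 + (sinh r)\<^sup>2))"

definition rho :: "real \<Rightarrow> real \<Rightarrow> real" where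
  "rho m r = - 2 * pi * (cosh r * sinh r / (m + (sinh r)\<^sup>2))"

definition xi_q1 :: "real \<Rightarrow> real \<Rightarrow> real \<Rightarrow> real" where
  "xi_q1 m r = analytic_extension {u. sn u m \<noteq> 0} (\<lambda>u. xi m r u * q1 m r u)"

definition xi_q2 :: "real \<Rightarrow> real \<Rightarrow> real \<Rightarrow> real" where
  "xi_q2 m r = analytic_extension {u. sn u m \<noteq> 0} (\<lambda>u. xi m r u * q2 m r u)"

definition x_tilde :: "real \<Rightarrow> real \<Rightarrow> real \<Rightarrow> real" where
  "x_tilde m r u = cos (psi m r u) * xi_q1 m r u - sin (psi m r u) * xi_q2 m r u"

definition y_tilde :: "real \<Rightarrow> real \<Rightarrow> real \<Rightarrow> real" where
  "y_tilde m r u = sin (psi m r u) * xi_q1 m r u + cos (psi m r u) * xi_q2 m r u"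

definition z_tilde :: "real \<Rightarrow> real \<Rightarrow> real \<Rightarrow> real" where
  "z_tilde m r u = zeta m r u"

definition f_tilde :: "real \<Rightarrow> real \<Rightarrow> real \<times> real \<Rightarrow> real^3" where
  "f_tilde m r = (\<lambda>(u, v). vector
     [cos (2 * pi * v) * x_tilde m r u - sin (2 * pi * v) * y_tilde m r u,
      sin (2 * pi * v) * x_tilde m r u + cos (2 * pi * v) * y_tilde m r u,
      z_tilde m r u + rho m r * v])"

end

theory Submission
  imports Defs "HOL-Complex_Analysis.Complex_Analysis"
begin

text \<open>
  A pseudospherical map is determined by its angle up to rigid motions. Its adapted frame
  \<open>e1, e2, e3\<close> satisfies a linear system whose coefficients depend only on the angle
  (lemma \<open>pseudospherical_frame_equations\<close>). For the helicoid the angle depends on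
  \<open>u = sinh r * s + cosh r * t\<close> alone, so the surface is invariant under a one-parameter group of
  screw motions, whose parameter is \<open>l = cosh r * s + sinh r * t\<close>, and the system can be solved by
  writing down the screw axis and a rotating frame about it.

  In detail, Jacobi's real transformation (\<open>am_reciprocal_parameter\<close>) replaces the parameter \<open>\<mu> > 1\<close>
  by \<open>m = 1 / \<mu>\<close> and expresses the coefficients of the system through \<open>sn\<close>, \<open>cn\<close>, \<open>dn\<close> at \<open>(u, m)\<close>.
  Explicit combinations \<open>radial\<close>, \<open>transverse\<close>, \<open>axial\<close> of the frame vectors are again orthonormal;
  \<open>axial\<close> is constant, and the other two rotate with angular velocity the derivative of
  \<open>psi u + w * l\<close>, where \<open>w\<^sup>2 = m + sinh\<^sup>2 r\<close>. Rotating back gives constant vectors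
  (\<open>rotated_frame_along_line\<close>). The sum of \<open>f\<close> and
  \<open>\<xi> q\<^sup>1 radial + \<xi> q\<^sup>2 transverse + (zeta u - cosh r * sinh r / w * l) axial\<close> is constant as well
  (\<open>position_along_line\<close>). Read in the constant frame, this says that \<open>- f\<close> is the parametrization of
  the theorem at \<open>(u, w * l / (2 * pi))\<close>, followed by a rigid motion; the orientation of that motion is
  checked at the origin. The constants of integration in \<open>psi\<close> and \<open>zeta\<close> are absorbed by it.
  All these identities reduce to polynomial ones in \<open>sn, cn, dn, sinh r, cosh r\<close>
  (locale \<open>frame_point\<close>).

  Analyticity comes from complex analysis. The amplitude is the inverse function of the elliptic integral,
  hence locally the restriction of a holomorphic function; \<open>psi\<close> and \<open>zeta\<close> are primitives of rational
  functions of \<open>sn\<close>; and \<open>\<xi> q\<^sup>1\<close>, \<open>\<xi> q\<^sup>2\<close> are regular after cancelling the powers of \<open>sn\<close>.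
\<close>

section \<open>Real analytic functions as germs of holomorphic functions\<close>

text \<open>Real analyticity is handled through germs of holomorphic extensions: there the inverse function
  theorem and the existence of primitives come with complex analysis, whereas a direct treatment of
  real power series would have to prove both by estimates on coefficients.\<close>

definition complexifiable :: "(real \<Rightarrow> real) \<Rightarrow> real \<Rightarrow> bool" where
  "complexifiable h x \<longleftrightarrow>
     (\<exists>H. H analytic_on {of_real x :: complex} \<and> (\<forall>\<^sub>F y in nhds x. H (of_real y) = of_real (h y)))"

lemma complexifiable_imp_isCont:
  assumes "complexifiable h x"
  shows "isCont h x"
proof -
  obtain H where H: "H analytic_on {of_real x :: complex}"
    and ev: "\<forall>\<^sub>F y in nhds x. H (of_real y) = of_real (h y)"
    using assms unfolding complexifiable_def by blast
  have cH: "isCont H (of_real x)"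
    using H analytic_on_imp_differentiable_at field_differentiable_imp_continuous_at by blast
  have "isCont (\<lambda>y. Re (H (of_real y))) x"
    by (rule isCont_Re[OF isCont_o2[OF isCont_of_real[OF continuous_ident] cH]])
  moreover have "\<forall>\<^sub>F y in nhds x. Re (H (of_real y)) = h y"
    using ev by (rule eventually_mono) simp
  ultimately show ?thesis
    by (simp add: isCont_cong)
qed

lemma complexifiable_analytic:
  assumes "H analytic_on {of_real x :: complex}" "\<And>y. H (of_real y) = of_real (h y)"
  shows "complexifiable h x"
  unfolding complexifiable_def using assms by auto

lemma complexifiable_const: "complexifiable (\<lambda>_. c) x"
  by (rule complexifiable_analytic[OF analytic_on_const]) (rule refl)

lemma complexifiable_ident: "complexifiable (\<lambda>y. y) x"
  by (rule complexifiable_analytic[OF analytic_on_ident]) (rule refl)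

lemma complexifiable_sin: "complexifiable sin x"
  by (rule complexifiable_analytic[of sin]) (simp_all add: analytic_on_sin[OF analytic_on_ident] sin_of_real)

lemma complexifiable_cos: "complexifiable cos x"
  by (rule complexifiable_analytic[of cos]) (simp_all add: analytic_on_cos[OF analytic_on_ident] cos_of_real)

lemma complexifiable_inverse:
  assumes "x \<noteq> 0"
  shows "complexifiable inverse x"
  by (rule complexifiable_analytic[OF analytic_on_inverse[OF analytic_on_ident]]) (use assms in simp_all)

lemma complexifiable_sqrt:
  assumes "x > 0"
  shows "complexifiable sqrt x"
  unfolding complexifiable_def
proof (intro exI conjI)
  have "open (- \<real>\<^sub>\<le>\<^sub>0 :: complex set)"
    using closed_nonpos_Reals_complex by (simp add: open_Compl)
  moreover have "complex_of_real x \<in> - \<real>\<^sub>\<le>\<^sub>0"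
    using assms by auto
  ultimately show "csqrt analytic_on {of_real x}"
    using holomorphic_on_csqrt holomorphic_on_imp_analytic_at by blast
  have "\<forall>\<^sub>F y in nhds x. 0 < y"
    using assms by (simp add: eventually_nhds_top order_tendstoD(1)[OF filterlim_ident])
  then show "\<forall>\<^sub>F y in nhds x. csqrt (of_real y) = of_real (sqrt y)"
    by eventually_elim (simp add: csqrt_of_real_nonneg)
qed

lemma complexifiable_add:
  assumes "complexifiable g x" "complexifiable h x"
  shows "complexifiable (\<lambda>y. g y + h y) x"
proof -
  obtain G H where "G analytic_on {of_real x :: complex}" "H analytic_on {of_real x :: complex}"
    and ev: "\<forall>\<^sub>F y in nhds x. G (of_real y) = of_real (g y)" "\<forall>\<^sub>F y in nhds x. H (of_real y) = of_real (h y)"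
    using assms unfolding complexifiable_def by blast
  then have "(\<lambda>z. G z + H z) analytic_on {of_real x}"
    by (intro analytic_intros)
  moreover have "\<forall>\<^sub>F y in nhds x. G (of_real y) + H (of_real y) = of_real (g y + h y)"
    using ev by eventually_elim simp
  ultimately show ?thesis
    unfolding complexifiable_def by (intro exI[of _ "\<lambda>z. G z + H z"]) auto
qed

lemma complexifiable_mult:
  assumes "complexifiable g x" "complexifiable h x"
  shows "complexifiable (\<lambda>y. g y * h y) x"
proof -
  obtain G H where "G analytic_on {of_real x :: complex}" "H analytic_on {of_real x :: complex}"
    and ev: "\<forall>\<^sub>F y in nhds x. G (of_real y) = of_real (g y)" "\<forall>\<^sub>F y in nhds x. H (of_real y) = of_real (h y)"
    using assms unfolding complexifiable_def by blast
  then have "(\<lambda>z. G z * H z) analytic_on {of_real x}"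
    by (intro analytic_intros)
  moreover have "\<forall>\<^sub>F y in nhds x. G (of_real y) * H (of_real y) = of_real (g y * h y)"
    using ev by eventually_elim simp
  ultimately show ?thesis
    unfolding complexifiable_def by (intro exI[of _ "\<lambda>z. G z * H z"]) auto
qed

lemma complexifiable_compose:
  assumes g: "complexifiable g (h x)" and h: "complexifiable h x"
  shows "complexifiable (\<lambda>y. g (h y)) x"
proof -
  obtain G where G: "G analytic_on {of_real (h x) :: complex}"
    and evG: "\<forall>\<^sub>F y in nhds (h x). G (of_real y) = of_real (g y)"
    using g unfolding complexifiable_def by blast
  obtain H where H: "H analytic_on {of_real x :: complex}"
    and evH: "\<forall>\<^sub>F y in nhds x. H (of_real y) = of_real (h y)"
    using h unfolding complexifiable_def by blast
  have "H (of_real x) = of_real (h x)"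
    using evH eventually_nhds_x_imp_x by fast
  then have "(G \<circ> H) analytic_on {of_real x}"
    using G by (intro analytic_on_compose_gen[OF H]) auto
  moreover have "filterlim h (nhds (h x)) (nhds x)"
    using complexifiable_imp_isCont[OF h] by (simp add: continuous_at tendsto_at_iff_tendsto_nhds)
  then have "\<forall>\<^sub>F y in nhds x. G (of_real (h y)) = of_real (g (h y))"
    using evG eventually_compose_filterlim by blast
  then have "\<forall>\<^sub>F y in nhds x. (G \<circ> H) (of_real y) = of_real (g (h y))"
    using evH by eventually_elim simp
  ultimately show ?thesis
    unfolding complexifiable_def by (intro exI[of _ "G \<circ> H"]) auto
qed

lemma complexifiable_minus:
  assumes "complexifiable h x"
  shows "complexifiable (\<lambda>y. - h y) x"
  using complexifiable_mult[OF complexifiable_const[of "-1"] assms] by simp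

lemma complexifiable_diff:
  assumes "complexifiable g x" "complexifiable h x"
  shows "complexifiable (\<lambda>y. g y - h y) x"
  using complexifiable_add[OF assms(1) complexifiable_minus[OF assms(2)]] by simp

lemma complexifiable_power:
  assumes "complexifiable h x"
  shows "complexifiable (\<lambda>y. h y ^ n) x"
  by (induction n) (auto intro: complexifiable_const complexifiable_mult assms)

lemma complexifiable_divide:
  assumes "complexifiable g x" "complexifiable h x" "h x \<noteq> 0"
  shows "complexifiable (\<lambda>y. g y / h y) x"
  using complexifiable_mult[OF assms(1) complexifiable_compose[OF complexifiable_inverse assms(2)]] assms(3)
  by (simp add: divide_inverse)

lemmas complexifiable_intros =
  complexifiable_const complexifiable_ident complexifiable_add complexifiable_mult
  complexifiable_minus complexifiable_diff complexifiable_power complexifiable_divide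
  complexifiable_compose[OF complexifiable_sin] complexifiable_compose[OF complexifiable_cos]
  complexifiable_compose[OF complexifiable_sqrt]

lemma holomorphic_ball_primitive:
  assumes "H holomorphic_on ball c e"
  shows "\<exists>G. \<forall>z \<in> ball c e. (G has_field_derivative H z) (at z)"
proof (rule holomorphic_convex_primitive'[OF convex_ball open_ball assms])
  fix g assume "\<And>z. z \<in> ball c e \<Longrightarrow> (g has_field_derivative H z) (at z within ball c e)"
  then show ?thesis by (intro exI[of _ g] ballI) (simp add: at_within_open[OF _ open_ball])
qed

text \<open>A primitive \<open>G\<close> of the holomorphic extension of \<open>h'\<close>, normalised to the value \<open>h x\<close> at \<open>x\<close>,
  restricts on the real line to a function with the derivative of \<open>h\<close>; both agree at \<open>x\<close>, hence near \<open>x\<close>.\<close>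

lemma real_primitive_locally_holomorphic:
  fixes h h' :: "real \<Rightarrow> real"
  assumes der: "\<And>y. (h has_real_derivative h' y) (at y)"
    and h': "complexifiable h' x"
  shows "\<exists>G e. 0 < e \<and> G holomorphic_on ball (of_real x) e \<and> deriv G (of_real x) = of_real (h' x) \<and>
    (\<forall>y. \<bar>y - x\<bar> < e \<longrightarrow> G (of_real y) = complex_of_real (h y))"
proof -
  obtain H where H: "H analytic_on {of_real x :: complex}"
    and ev: "\<forall>\<^sub>F y in nhds x. H (of_real y) = of_real (h' y)"
    using h' unfolding complexifiable_def by blast
  obtain e1 where e1: "0 < e1" "H holomorphic_on ball (of_real x) e1"
    using H analytic_at_ball by blast
  obtain e2 where e2: "0 < e2" "\<And>y. dist y x < e2 \<Longrightarrow> H (of_real y) = of_real (h' y)"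
    using ev unfolding eventually_nhds_metric by blast
  define e where "e = min e1 e2"
  have e: "0 < e" "e \<le> e1" "e \<le> e2"
    using e1(1) e2(1) by (auto simp: e_def)
  have "H holomorphic_on ball (of_real x) e"
    using e1(2) by (rule holomorphic_on_subset) (use e(2) in \<open>simp add: subset_ball\<close>)
  then obtain G0 where G0: "\<forall>z \<in> ball (of_real x) e. (G0 has_field_derivative H z) (at z)"
    using holomorphic_ball_primitive by metis
  define G where "G z = G0 z - G0 (of_real x) + of_real (h x)" for z
  have G: "(G has_field_derivative H z) (at z)" if "z \<in> ball (of_real x) e" for z
    unfolding G_def using bspec[OF G0 that] by (auto intro!: derivative_eq_intros)
  show ?thesis
  proof (intro exI conjI allI impI)
    show "0 < e" by (rule e)
    show "G holomorphic_on ball (of_real x) e"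
      using G holomorphic_on_open open_ball by blast
    show "deriv G (of_real x) = of_real (h' x)"
      using G[of "of_real x"] e e2(2)[of x] e2(1) by (simp add: DERIV_imp_deriv)
    fix y assume y: "\<bar>y - x\<bar> < e"
    define D where "D t = G (of_real t) - complex_of_real (h t)" for t
    have "(D has_vector_derivative 0) (at t within ball x e)" if t: "t \<in> ball x e" for t
    proof -
      have "complex_of_real t \<in> ball (of_real x) e"
        using t by (simp add: dist_of_real)
      then have "(G has_field_derivative H (of_real t)) (at (of_real t))" by (rule G)
      then have "((G \<circ> of_real) has_vector_derivative (1 * H (of_real t))) (at t)"
        by (intro field_vector_diff_chain_at) (auto intro!: derivative_eq_intros)
      moreover have "((\<lambda>t. complex_of_real (h t)) has_vector_derivative of_real (h' t)) (at t)"
        using has_vector_derivative_of_real der has_real_derivative_iff_has_vector_derivative by blast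
      moreover have "H (of_real t) = of_real (h' t)"
        using t e by (intro e2) (auto simp: dist_commute)
      ultimately have "(D has_vector_derivative 0) (at t)"
        unfolding D_def using has_vector_derivative_diff by (fastforce simp: o_def)
      then show ?thesis
        using has_vector_derivative_at_within by blast
    qed
    then obtain c where c: "\<And>t. t \<in> ball x e \<Longrightarrow> D t = c"
      using has_vector_derivative_zero_constant[of "ball x e" D] by auto
    have "c = 0"
      using c[of x] e by (simp add: D_def G_def)
    then show "G (of_real y) = complex_of_real (h y)"
      using c[of y] y by (simp add: D_def dist_real_def abs_minus_commute)
  qed
qed

lemma complexifiable_primitive:
  assumes der: "\<And>y. (h has_real_derivative h' y) (at y)"
    and h': "complexifiable h' x"
  shows "complexifiable h x"
proof -
  obtain G e where G: "0 < e" "G holomorphic_on ball (of_real x) e"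
    "\<forall>y. \<bar>y - x\<bar> < e \<longrightarrow> G (of_real y) = complex_of_real (h y)"
    using real_primitive_locally_holomorphic[OF der h'] by (elim exE conjE) (rule that)
  then have "G analytic_on {of_real x}"
    using analytic_at_ball by blast
  moreover have "\<forall>\<^sub>F y in nhds x. G (of_real y) = of_real (h y)"
    using G(1,3) by (auto simp: eventually_nhds_metric dist_real_def)
  ultimately show ?thesis
    unfolding complexifiable_def by blast
qed

text \<open>The holomorphic extension of \<open>F\<close> has nonzero derivative at \<open>g x\<close> and therefore a local
  holomorphic inverse. Continuity of \<open>g\<close> keeps \<open>g y\<close> in the domain of that inverse, so that \<open>g\<close> is its
  restriction to the real line.\<close>

lemma complexifiable_inverse_function:
  assumes der: "\<And>y. (F has_real_derivative F' y) (at y)"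
    and F': "complexifiable F' (g x)" "F' (g x) \<noteq> 0"
    and g: "\<And>y. F (g y) = y" "isCont g x"
  shows "complexifiable g x"
proof -
  define \<phi> where "\<phi> = complex_of_real (g x)"
  obtain G e where e: "0 < e" and hol: "G holomorphic_on ball \<phi> e"
    and G: "deriv G \<phi> = of_real (F' (g x))"
    "\<forall>y. \<bar>y - g x\<bar> < e \<longrightarrow> G (of_real y) = complex_of_real (F y)"
    using real_primitive_locally_holomorphic[OF der F'(1), folded \<phi>_def] by (elim exE conjE) (rule that)
  have "\<phi> \<in> ball \<phi> e" "deriv G \<phi> \<noteq> 0"
    using e G(1) F'(2) by auto
  then obtain r where r: "r > 0" "ball \<phi> r \<subseteq> ball \<phi> e" "open (G ` ball \<phi> r)" "inj_on G (ball \<phi> r)"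
    using has_complex_derivative_locally_invertible[OF hol _ open_ball] by blast
  obtain I where I: "I holomorphic_on (G ` ball \<phi> r)" "\<forall>z \<in> ball \<phi> r. I (G z) = z"
    by (rule holomorphic_has_inverse[OF holomorphic_on_subset[OF hol r(2)] open_ball r(4)])
      (rule that, assumption, simp add: ball_def)
  have Gg: "G (of_real (g y)) = of_real y" if "\<bar>g y - g x\<bar> < e" for y
    using G(2) that g(1) by simp
  have "of_real x \<in> G ` ball \<phi> r"
    using Gg[of x] e r(1) unfolding \<phi>_def by (metis abs_zero cancel_comm_monoid_add_class.diff_cancel centre_in_ball image_eqI)
  then have "I analytic_on {of_real x}"
    using I(1) r(3) holomorphic_on_imp_analytic_at by blast
  moreover have "\<forall>\<^sub>F y in nhds x. \<bar>g y - g x\<bar> < min e r"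
  proof -
    have "(g \<longlongrightarrow> g x) (nhds x)"
      using g(2) by (simp add: continuous_at tendsto_at_iff_tendsto_nhds)
    then show ?thesis
      using e r(1) tendstoD[of g "g x" "nhds x" "min e r"] by (simp add: dist_real_def)
  qed
  then have "\<forall>\<^sub>F y in nhds x. I (of_real y) = of_real (g y)"
  proof eventually_elim
    case (elim y)
    then have "complex_of_real (g y) \<in> ball \<phi> r"
      by (simp add: \<phi>_def dist_of_real dist_real_def abs_minus_commute)
    then show ?case
      using bspec[OF I(2), of "of_real (g y)"] Gg[of y] elim by simp
  qed
  ultimately show ?thesis
    unfolding complexifiable_def by blast
qed

text \<open>On the real line the power series of the extension has real values, so its coefficients may be
  replaced by their real parts.\<close>

lemma complexifiable_imp_real_analytic:
  assumes "\<And>x. complexifiable h x"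
  shows "real_analytic h"
  unfolding real_analytic_def
proof
  fix x
  obtain H where H: "H analytic_on {of_real x :: complex}"
    and ev: "\<forall>\<^sub>F y in nhds x. H (of_real y) = of_real (h y)"
    using assms unfolding complexifiable_def by blast
  obtain e1 where e1: "0 < e1" "H holomorphic_on ball (of_real x) e1"
    using H analytic_at_ball by blast
  obtain e2 where e2: "0 < e2" "\<And>y. dist y x < e2 \<Longrightarrow> H (of_real y) = of_real (h y)"
    using ev unfolding eventually_nhds_metric by blast
  define c where "c n = (deriv ^^ n) H (of_real x) / fact n" for n
  have "(\<lambda>n. Re (c n) * (y - x) ^ n) sums h y" if "\<bar>y - x\<bar> < min e1 e2" for y
  proof -
    have "(\<lambda>n. c n * (of_real y - of_real x) ^ n) sums H (of_real y)"
      unfolding c_def using that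
      by (intro holomorphic_power_series[OF e1(2)]) (simp add: dist_of_real dist_real_def abs_minus_commute)
    then have "(\<lambda>n. Re (c n * (of_real y - of_real x) ^ n)) sums Re (H (of_real y))"
      by (rule sums_Re)
    moreover have "Re (c n * (of_real y - of_real x) ^ n) = Re (c n) * (y - x) ^ n" for n
      by (simp flip: of_real_diff of_real_power)
    moreover have "H (of_real y) = of_real (h y)"
      using that by (intro e2) (simp add: dist_real_def)
    ultimately show ?thesis by simp
  qed
  then show "\<exists>\<epsilon>>0. \<exists>c. \<forall>y. \<bar>y - x\<bar> < \<epsilon> \<longrightarrow> (\<lambda>n. c n * (y - x) ^ n) sums h y"
    using e1(1) e2(1) by (intro exI[of _ "min e1 e2"] conjI exI[of _ "\<lambda>n. Re (c n)"]) auto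
qed

lemma real_analytic_imp_isCont:
  assumes "real_analytic h"
  shows "isCont h x"
proof -
  obtain e c where e: "e > 0" and c: "\<And>y. \<bar>y - x\<bar> < e \<Longrightarrow> (\<lambda>n. c n * (y - x) ^ n) sums h y"
    using assms unfolding real_analytic_def by metis
  have "summable (\<lambda>n. c n * (e / 2) ^ n)"
    using c[of "x + e / 2"] e by (auto simp: sums_iff)
  then have "isCont (\<lambda>t. \<Sum>n. c n * t ^ n) (x - x)"
    by (rule isCont_powser) (use e in \<open>simp add: abs_if\<close>)
  then have "isCont (\<lambda>y. \<Sum>n. c n * (y - x) ^ n) x"
    by (intro isCont_o2[where f = "\<lambda>y. y - x" and g = "\<lambda>t. \<Sum>n. c n * t ^ n"] continuous_intros)
  moreover have "\<forall>\<^sub>F y in nhds x. (\<Sum>n. c n * (y - x) ^ n) = h y"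
    using e c by (auto simp: eventually_nhds_metric dist_real_def sums_iff intro!: exI[of _ e])
  ultimately show ?thesis
    by (simp add: isCont_cong)
qed

text \<open>An extension is found by exhibiting it: two real analytic functions are in particular continuous,
  so agreement on a set that accumulates everywhere determines them.\<close>

lemma analytic_extension_eqI:
  assumes h: "real_analytic h" "\<And>u. u \<in> A \<Longrightarrow> h u = g u"
    and dense: "\<And>x. x islimpt A"
  shows "analytic_extension A g = h"
  unfolding analytic_extension_def
proof (rule the_equality)
  show "real_analytic h \<and> (\<forall>u\<in>A. h u = g u)" using h by blast
  fix k assume k: "real_analytic k \<and> (\<forall>u\<in>A. k u = g u)"
  show "k = h"
  proof
    fix x
    have lim: "(k \<longlongrightarrow> k x) (at x within A)" "(h \<longlongrightarrow> h x) (at x within A)"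
      using real_analytic_imp_isCont k h(1) by (auto simp: isCont_def intro: tendsto_within_subset)
    have "\<forall>\<^sub>F y in at x within A. k y = h y"
      using k h(2) by (auto simp: eventually_at_filter)
    then have "(h \<longlongrightarrow> k x) (at x within A)"
      using lim(1) tendsto_cong by blast
    then show "k x = h x"
      using lim(2) dense[of x] tendsto_unique trivial_limit_within by blast
  qed
qed

text \<open>Inside the disc of convergence both power series converge absolutely, so the product of the
  two sums is the unconditional sum of the products of their terms.\<close>

lemma real_analytic2_product:
  assumes a: "real_analytic a" and b: "real_analytic b"
  shows "real_analytic2 (\<lambda>(u, v). (a u * b v) *\<^sub>R w)"
  unfolding real_analytic2_def
proof (intro allI)
  have abs: "\<exists>e>0. \<exists>c. \<forall>x. \<bar>x - x0\<bar> < e \<longrightarrow> summable (\<lambda>n. norm (c n * (x - x0) ^ n)) \<and>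
      (\<lambda>n. c n * (x - x0) ^ n) sums h x" if h: "real_analytic h" for h :: "real \<Rightarrow> real" and x0
  proof -
    obtain e c where e: "e > 0" and c: "\<And>y. \<bar>y - x0\<bar> < e \<Longrightarrow> (\<lambda>n. c n * (y - x0) ^ n) sums h y"
      using h unfolding real_analytic_def by metis
    have "summable (\<lambda>n. norm (c n * (x - x0) ^ n))" if x: "\<bar>x - x0\<bar> < e" for x
    proof (rule powser_insidea)
      \<comment> \<open>a point strictly between \<open>x\<close> and the boundary of the interval of convergence\<close>
      show "summable (\<lambda>n. c n * ((\<bar>x - x0\<bar> + e) / 2) ^ n)"
        using c[of "x0 + (\<bar>x - x0\<bar> + e) / 2"] x by (auto simp: sums_iff)
      show "norm (x - x0) < norm ((\<bar>x - x0\<bar> + e) / 2)"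
        using x by simp
    qed
    then show ?thesis
      using c by (intro exI[of _ e] exI[of _ c] conjI e allI impI)
  qed
  fix x0 y0
  obtain e1 c1 where 1: "e1 > 0" "\<forall>x. \<bar>x - x0\<bar> < e1 \<longrightarrow> summable (\<lambda>n. norm (c1 n * (x - x0) ^ n)) \<and>
      (\<lambda>n. c1 n * (x - x0) ^ n) sums a x"
    using abs[OF a, of x0] by (elim exE conjE) (rule that)
  obtain e2 c2 where 2: "e2 > 0" "\<forall>y. \<bar>y - y0\<bar> < e2 \<longrightarrow> summable (\<lambda>n. norm (c2 n * (y - y0) ^ n)) \<and>
      (\<lambda>n. c2 n * (y - y0) ^ n) sums b y"
    using abs[OF b, of y0] by (elim exE conjE) (rule that)
  have "((\<lambda>(i, j). ((x - x0) ^ i * (y - y0) ^ j) *\<^sub>R ((c1 i * c2 j) *\<^sub>R w)) has_sum (a x * b y) *\<^sub>R w) UNIV"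
    if x: "\<bar>x - x0\<bar> < min e1 e2" and y: "\<bar>y - y0\<bar> < min e1 e2" for x y
  proof -
    define p where "p i = c1 i * (x - x0) ^ i" for i
    define q where "q j = c2 j * (y - y0) ^ j" for j
    have p: "summable (\<lambda>n. norm (p n))" "p sums a x" and q: "summable (\<lambda>n. norm (q n))" "q sums b y"
      using 1(2) 2(2) x y unfolding p_def q_def by auto
    have "((\<lambda>(i, j). p i * q j) has_sum a x * b y) (UNIV \<times> UNIV)"
    proof (rule has_sum_SigmaI)
      show "((\<lambda>j. case (i, j) of (i, j) \<Rightarrow> p i * q j) has_sum p i * b y) UNIV" for i
        using has_sum_cmult_right[OF norm_summable_imp_has_sum[OF q]] by simp
      show "((\<lambda>i. p i * b y) has_sum a x * b y) UNIV"
        by (rule has_sum_cmult_left[OF norm_summable_imp_has_sum[OF p]])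
      have nq: "((\<lambda>j. norm (q j)) has_sum (\<Sum>j. norm (q j))) UNIV"
        using q(1) by (intro norm_summable_imp_has_sum) (auto simp: summable_sums)
      have "(\<lambda>(i, j). norm (p i) * norm (q j)) summable_on UNIV \<times> UNIV"
      proof (rule summable_on_SigmaI)
        show "((\<lambda>j. case (i, j) of (i, j) \<Rightarrow> norm (p i) * norm (q j)) has_sum norm (p i) * (\<Sum>j. norm (q j))) UNIV" for i
          using has_sum_cmult_right[OF nq] by simp
        have "(\<lambda>i. norm (p i)) summable_on UNIV"
          using p(1) by (intro norm_summable_imp_summable_on) simp
        then show "(\<lambda>i. norm (p i) * (\<Sum>j. norm (q j))) summable_on UNIV"
          by (rule summable_on_cmult_left)
      qed auto
      then have "(\<lambda>z. norm (case z of (i, j) \<Rightarrow> p i * q j)) summable_on UNIV \<times> UNIV"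
        by (simp add: case_prod_unfold abs_mult)
      then show "(\<lambda>(i, j). p i * q j) summable_on UNIV \<times> UNIV"
        by (rule abs_summable_summable)
    qed
    then have "((\<lambda>z. (case z of (i, j) \<Rightarrow> p i * q j) *\<^sub>R w) has_sum (a x * b y) *\<^sub>R w) UNIV"
      using has_sum_bounded_linear[OF bounded_linear_scaleR_left] by fastforce
    moreover have "(\<lambda>z. (case z of (i, j) \<Rightarrow> p i * q j) *\<^sub>R w) =
        (\<lambda>(i, j). ((x - x0) ^ i * (y - y0) ^ j) *\<^sub>R ((c1 i * c2 j) *\<^sub>R w))"
      by (auto simp: p_def q_def fun_eq_iff)
    ultimately show ?thesis by simp
  qed
  then show "\<exists>\<epsilon>>0. \<exists>c. \<forall>x y. \<bar>x - x0\<bar> < \<epsilon> \<and> \<bar>y - y0\<bar> < \<epsilon> \<longrightarrow>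
      ((\<lambda>(i, j). ((x - x0) ^ i * (y - y0) ^ j) *\<^sub>R c i j) has_sum
       (case (x, y) of (u, v) \<Rightarrow> (a u * b v) *\<^sub>R w)) UNIV"
    using 1(1) 2(1)
    by (intro exI[of _ "min e1 e2"] conjI exI[of _ "\<lambda>i j. (c1 i * c2 j) *\<^sub>R w"]) auto
qed

lemma real_analytic2_add:
  assumes "real_analytic2 f" "real_analytic2 g"
  shows "real_analytic2 (\<lambda>z. f z + g z)"
  unfolding real_analytic2_def
proof (intro allI)
  fix x0 y0
  obtain e1 c1 where 1: "e1 > 0" "\<forall>x y. \<bar>x - x0\<bar> < e1 \<and> \<bar>y - y0\<bar> < e1 \<longrightarrow>
      ((\<lambda>(i, j). ((x - x0) ^ i * (y - y0) ^ j) *\<^sub>R c1 i j) has_sum f (x, y)) UNIV"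
    using assms(1)[unfolded real_analytic2_def, rule_format, of x0 y0] by (elim exE conjE) (rule that)
  obtain e2 c2 where 2: "e2 > 0" "\<forall>x y. \<bar>x - x0\<bar> < e2 \<and> \<bar>y - y0\<bar> < e2 \<longrightarrow>
      ((\<lambda>(i, j). ((x - x0) ^ i * (y - y0) ^ j) *\<^sub>R c2 i j) has_sum g (x, y)) UNIV"
    using assms(2)[unfolded real_analytic2_def, rule_format, of x0 y0] by (elim exE conjE) (rule that)
  have "((\<lambda>(i, j). ((x - x0) ^ i * (y - y0) ^ j) *\<^sub>R (c1 i j + c2 i j)) has_sum f (x, y) + g (x, y)) UNIV"
    if "\<bar>x - x0\<bar> < min e1 e2" "\<bar>y - y0\<bar> < min e1 e2" for x y
    using has_sum_add[OF 1(2)[rule_format, of x y] 2(2)[rule_format, of x y]] that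
    by (simp add: case_prod_unfold scaleR_add_right)
  then show "\<exists>\<epsilon>>0. \<exists>c. \<forall>x y. \<bar>x - x0\<bar> < \<epsilon> \<and> \<bar>y - y0\<bar> < \<epsilon> \<longrightarrow>
      ((\<lambda>(i, j). ((x - x0) ^ i * (y - y0) ^ j) *\<^sub>R c i j) has_sum f (x, y) + g (x, y)) UNIV"
    using 1(1) 2(1) by (intro exI[of _ "min e1 e2"] conjI exI[of _ "\<lambda>i j. c1 i j + c2 i j"]) auto
qed

section \<open>The Jacobi amplitude\<close>

lemma interval_lebesgue_integral_has_derivative:
  fixes f :: "real \<Rightarrow> real"
  assumes "continuous_on UNIV f"
  shows "((\<lambda>x. LBINT t=0..x. f t) has_real_derivative f x) (at x)"
proof -
  have "((\<lambda>u. LBINT t=ereal 0..ereal u. f t) has_vector_derivative f x) (at x within {min 0 x - 1..max 0 x + 1})"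
    by (rule interval_integral_FTC2) (auto intro: continuous_on_subset[OF assms])
  moreover have "at x within {min 0 x - 1..max 0 x + 1} = at x"
    by (rule at_within_interior) (auto simp: interior_atLeastAtMost_real)
  ultimately show ?thesis
    by (simp add: has_real_derivative_iff_has_vector_derivative zero_ereal_def)
qed

lemma sin_times_cos_lipschitz: "\<bar>sin a * cos a - sin b * cos b\<bar> \<le> \<bar>a - b :: real\<bar>"
proof -
  have "sin a * cos a - sin b * cos b = sin (a - b) * cos (a + b)"
  proof -
    have "sin (a - b) * cos (a + b) = (sin a * cos b - cos a * sin b) * (cos a * cos b - sin a * sin b)"
      by (simp add: sin_diff cos_add)
    also have "\<dots> = sin a * cos a * ((sin b)\<^sup>2 + (cos b)\<^sup>2) - sin b * cos b * ((sin a)\<^sup>2 + (cos a)\<^sup>2)"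
      by algebra
    finally show ?thesis by simp
  qed
  then have "\<bar>sin a * cos a - sin b * cos b\<bar> = \<bar>sin (a - b)\<bar> * \<bar>cos (a + b)\<bar>"
    by (simp add: abs_mult)
  also have "\<dots> \<le> \<bar>sin (a - b)\<bar> * 1"
    by (intro mult_left_mono) auto
  finally show ?thesis
    using abs_sin_x_le_abs_x[of "a - b"] by linarith
qed

text \<open>The bound makes \<open>E x * exp (- C * x)\<close> decreasing and \<open>E x * exp (C * x)\<close> increasing. Both vanish
  at 0 and are nonnegative, which settles the positive and the negative half line respectively.\<close>

lemma gronwall_zero:
  fixes E E' :: "real \<Rightarrow> real"
  assumes der: "\<And>x. (E has_real_derivative E' x) (at x)"
    and bound: "\<And>x. \<bar>E' x\<bar> \<le> C * E x"
    and nonneg: "\<And>x. 0 \<le> E x" and zero: "E 0 = 0"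
  shows "E x = 0"
proof (cases "0 \<le> x")
  case True
  have "E x * exp (- C * x) \<le> E 0 * exp (- C * 0)"
  proof (rule DERIV_nonpos_imp_nonincreasing[OF True, where f = "\<lambda>t. E t * exp (- C * t)"])
    fix t
    have "((\<lambda>t. E t * exp (- C * t)) has_real_derivative (E' t - C * E t) * exp (- C * t)) (at t)"
      by (auto intro!: derivative_eq_intros der simp: algebra_simps)
    moreover have "(E' t - C * E t) * exp (- C * t) \<le> 0"
      using bound[of t] by (intro mult_nonpos_nonneg) auto
    ultimately show "\<exists>y. ((\<lambda>t. E t * exp (- C * t)) has_real_derivative y) (at t) \<and> y \<le> 0"
      by blast
  qed
  then have "E x * exp (- C * x) \<le> 0" using zero by simp
  then show ?thesis using nonneg[of x] by (simp add: mult_le_0_iff)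
next
  case False
  have "E x * exp (C * x) \<le> E 0 * exp (C * 0)"
  proof (rule DERIV_nonneg_imp_nondecreasing[where f = "\<lambda>t. E t * exp (C * t)"])
    show "x \<le> 0" using False by simp
    fix t
    have "((\<lambda>t. E t * exp (C * t)) has_real_derivative (E' t + C * E t) * exp (C * t)) (at t)"
      by (auto intro!: derivative_eq_intros der simp: algebra_simps)
    moreover have "(E' t + C * E t) * exp (C * t) \<ge> 0"
      using bound[of t] by (intro mult_nonneg_nonneg) auto
    ultimately show "\<exists>y. ((\<lambda>t. E t * exp (C * t)) has_real_derivative y) (at t) \<and> 0 \<le> y"
      by blast
  qed
  then have "E x * exp (C * x) \<le> 0" using zero by simp
  then show ?thesis using nonneg[of x] by (simp add: mult_le_0_iff)
qed

text \<open>The squared distance of two solutions of the pendulum equation in phase space satisfies the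
  hypothesis of the Gronwall lemma, because \<open>sin \<theta> * cos \<theta>\<close> is Lipschitz. This is what gives the
  definite description in the definition of \<^const>\<open>am\<close> a meaning; existence comes from explicit solutions.\<close>

lemma is_amplitude_unique:
  assumes "is_amplitude \<mu> \<alpha>" "is_amplitude \<mu> \<beta>"
  shows "\<alpha> = \<beta>"
proof
  fix x
  obtain a where a: "\<And>x. (\<alpha> has_real_derivative a x) (at x)"
    "\<And>x. (a has_real_derivative (- \<mu> * sin (\<alpha> x) * cos (\<alpha> x))) (at x)" "\<alpha> 0 = 0" "a 0 = 1"
    using assms(1) unfolding is_amplitude_def by blast
  obtain b where b: "\<And>x. (\<beta> has_real_derivative b x) (at x)"
    "\<And>x. (b has_real_derivative (- \<mu> * sin (\<beta> x) * cos (\<beta> x))) (at x)" "\<beta> 0 = 0" "b 0 = 1"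
    using assms(2) unfolding is_amplitude_def by blast
  define D where "D x = \<alpha> x - \<beta> x" for x
  define d where "d x = a x - b x" for x
  define s where "s x = sin (\<alpha> x) * cos (\<alpha> x) - sin (\<beta> x) * cos (\<beta> x)" for x
  have D: "(D has_real_derivative d x) (at x)" for x
    unfolding D_def d_def by (intro derivative_intros a b)
  have d: "(d has_real_derivative - \<mu> * s x) (at x)" for x
    unfolding d_def s_def by (auto intro!: derivative_eq_intros a(2) b(2) simp: algebra_simps)
  have "(D x)\<^sup>2 + (d x)\<^sup>2 = 0"
  proof (rule gronwall_zero[where E = "\<lambda>x. (D x)\<^sup>2 + (d x)\<^sup>2" and C = "1 + \<bar>\<mu>\<bar>"])
    fix x
    show "((\<lambda>x. (D x)\<^sup>2 + (d x)\<^sup>2) has_real_derivative 2 * d x * D x - 2 * \<mu> * s x * d x) (at x)"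
      by (auto intro!: derivative_eq_intros D d simp: algebra_simps)
    have "\<bar>s x\<bar> \<le> \<bar>D x\<bar>"
      unfolding s_def D_def by (rule sin_times_cos_lipschitz)
    then have "\<bar>\<mu>\<bar> * (2 * \<bar>s x\<bar> * \<bar>d x\<bar>) \<le> \<bar>\<mu>\<bar> * (2 * \<bar>D x\<bar> * \<bar>d x\<bar>)"
      by (intro mult_left_mono mult_right_mono) auto
    moreover have "\<bar>2 * d x * D x - 2 * \<mu> * s x * d x\<bar> \<le> 2 * \<bar>D x\<bar> * \<bar>d x\<bar> + \<bar>\<mu>\<bar> * (2 * \<bar>s x\<bar> * \<bar>d x\<bar>)"
      using abs_triangle_ineq4[of "2 * d x * D x" "2 * \<mu> * s x * d x"]
      by (simp add: abs_mult algebra_simps)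
    ultimately have "\<bar>2 * d x * D x - 2 * \<mu> * s x * d x\<bar> \<le> (1 + \<bar>\<mu>\<bar>) * (2 * \<bar>D x\<bar> * \<bar>d x\<bar>)"
      by (simp add: algebra_simps)
    also have "\<dots> \<le> (1 + \<bar>\<mu>\<bar>) * ((D x)\<^sup>2 + (d x)\<^sup>2)"
      using sum_squares_bound[of "\<bar>D x\<bar>" "\<bar>d x\<bar>"] by (intro mult_left_mono) auto
    finally show "\<bar>2 * d x * D x - 2 * \<mu> * s x * d x\<bar> \<le> (1 + \<bar>\<mu>\<bar>) * ((D x)\<^sup>2 + (d x)\<^sup>2)" .
  qed (use a(3,4) b(3,4) in \<open>auto simp: D_def d_def\<close>)
  then show "\<alpha> x = \<beta> x"
    by (simp add: D_def sum_power2_eq_zero_iff)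
qed

lemma am_eqI:
  assumes "is_amplitude \<mu> \<theta>"
  shows "am x \<mu> = \<theta> x"
  using the_equality[of "is_amplitude \<mu>" \<theta>] assms is_amplitude_unique unfolding am_def by metis

lemma one_minus_m_sin_squared_pos:
  assumes "0 < m" "m < 1"
  shows "0 < 1 - m * (sin \<phi> :: real)\<^sup>2"
proof -
  have "m * (sin \<phi>)\<^sup>2 \<le> m * 1"
    using assms by (intro mult_left_mono) (auto simp: abs_square_le_1)
  then show ?thesis using assms by linarith
qed

lemma ellF_has_derivative:
  assumes "0 < m" "m < 1"
  shows "((\<lambda>\<phi>. ellF \<phi> m) has_real_derivative 1 / sqrt (1 - m * (sin \<phi>)\<^sup>2)) (at \<phi>)"
  unfolding ellF_def
  by (rule interval_lebesgue_integral_has_derivative)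
    (intro continuous_intros ballI, use one_minus_m_sin_squared_pos[OF assms] in \<open>simp add: less_le\<close>)

text \<open>The integrand is at least 1. Growth at this rate gives injectivity, surjectivity and
  continuity of the inverse at once.\<close>

lemma ellF_expanding:
  assumes "0 < m" "m < 1" "a \<le> b"
  shows "b - a \<le> ellF b m - ellF a m"
proof -
  have "ellF a m - a \<le> ellF b m - b"
  proof (rule DERIV_nonneg_imp_nondecreasing[OF assms(3), where f = "\<lambda>x. ellF x m - x"])
    fix x
    have "1 \<le> 1 / sqrt (1 - m * (sin x)\<^sup>2)"
      using one_minus_m_sin_squared_pos[OF assms(1,2), of x] assms by (simp add: real_sqrt_le_1_iff)
    then show "\<exists>y. ((\<lambda>x. ellF x m - x) has_real_derivative y) (at x) \<and> 0 \<le> y"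
      by (intro exI[of _ "1 / sqrt (1 - m * (sin x)\<^sup>2) - 1"] conjI)
        (auto intro!: derivative_eq_intros ellF_has_derivative[OF assms(1,2)])
  qed
  then show ?thesis by simp
qed

lemma ellF_surj:
  assumes "0 < m" "m < 1"
  shows "\<exists>\<phi>. ellF \<phi> m = y"
proof -
  have zero: "ellF 0 m = 0"
    by (simp add: ellF_def zero_ereal_def[symmetric])
  have "\<exists>x\<ge>- \<bar>y\<bar>. x \<le> \<bar>y\<bar> \<and> ellF x m = y"
  proof (rule IVT')
    show "ellF (- \<bar>y\<bar>) m \<le> y" "y \<le> ellF \<bar>y\<bar> m"
      using ellF_expanding[OF assms, of "- \<bar>y\<bar>" 0] ellF_expanding[OF assms, of 0 "\<bar>y\<bar>"] zero
      by auto
    show "continuous_on {- \<bar>y\<bar>..\<bar>y\<bar>} (\<lambda>x. ellF x m)"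
      using ellF_has_derivative[OF assms] DERIV_isCont continuous_at_imp_continuous_on by blast
  qed simp
  then show ?thesis by blast
qed

text \<open>For a parameter in \<open>(0, 1)\<close> the amplitude is the inverse of the incomplete elliptic integral on
  the whole line, from which all derivatives and the analyticity of the Jacobi functions follow.\<close>

locale elliptic_parameter =
  fixes m :: real
  assumes m_pos: "0 < m" and m_less_1: "m < 1"
begin

definition ellF_inverse :: "real \<Rightarrow> real" where
  "ellF_inverse y = (SOME \<phi>. ellF \<phi> m = y)"

lemma ellF_ellF_inverse: "ellF (ellF_inverse y) m = y"
  unfolding ellF_inverse_def by (rule someI_ex) (rule ellF_surj[OF m_pos m_less_1])

lemma ellF_inverse_isCont: "isCont ellF_inverse x"
proof -
  have "\<bar>ellF_inverse y - ellF_inverse x\<bar> \<le> \<bar>y - x\<bar>" for y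
    using ellF_expanding[OF m_pos m_less_1, of "ellF_inverse x" "ellF_inverse y"]
      ellF_expanding[OF m_pos m_less_1, of "ellF_inverse y" "ellF_inverse x"]
    by (auto simp: ellF_ellF_inverse abs_if)
  then show ?thesis
    unfolding isCont_def LIM_def dist_real_def by (meson le_less_trans)
qed

lemma ellF_inverse_has_derivative:
  "(ellF_inverse has_real_derivative sqrt (1 - m * (sin (ellF_inverse x))\<^sup>2)) (at x)"
proof -
  have "(ellF_inverse has_real_derivative inverse (1 / sqrt (1 - m * (sin (ellF_inverse x))\<^sup>2))) (at x)"
    using one_minus_m_sin_squared_pos[OF m_pos m_less_1, of "ellF_inverse x"]
    by (intro DERIV_inverse_function[where f = "\<lambda>\<phi>. ellF \<phi> m" and a = "x - 1" and b = "x + 1"]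
        ellF_has_derivative m_pos m_less_1)
      (simp_all add: ellF_ellF_inverse ellF_inverse_isCont)
  then show ?thesis by simp
qed

lemma is_amplitude_ellF_inverse: "is_amplitude m ellF_inverse"
  unfolding is_amplitude_def
proof (intro exI conjI allI)
  let ?d = "\<lambda>x. sqrt (1 - m * (sin (ellF_inverse x))\<^sup>2)"
  show "(ellF_inverse has_real_derivative ?d x) (at x)" for x
    by (rule ellF_inverse_has_derivative)
  show "(?d has_real_derivative - m * sin (ellF_inverse x) * cos (ellF_inverse x)) (at x)" for x
    using one_minus_m_sin_squared_pos[OF m_pos m_less_1, of "ellF_inverse x"]
    by (auto intro!: derivative_eq_intros ellF_inverse_has_derivative simp: field_simps)
  have "ellF 0 m = 0"
    by (simp add: ellF_def zero_ereal_def[symmetric])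
  then show "ellF_inverse 0 = 0"
    using ellF_expanding[OF m_pos m_less_1, of "ellF_inverse 0" 0]
      ellF_expanding[OF m_pos m_less_1, of 0 "ellF_inverse 0"] ellF_ellF_inverse[of 0]
    by linarith
  then show "?d 0 = 1" by simp
qed

lemma am_eq_ellF_inverse: "am x m = ellF_inverse x"
  by (rule am_eqI[OF is_amplitude_ellF_inverse])

lemma ellF_am: "ellF (am x m) m = x"
  by (simp add: am_eq_ellF_inverse ellF_ellF_inverse)

lemma am_has_derivative_sqrt:
  "((\<lambda>x. am x m) has_real_derivative sqrt (1 - m * (sn x m)\<^sup>2)) (at x)"
  using ellF_inverse_has_derivative by (simp add: am_eq_ellF_inverse sn_def)

lemma dn_eq: "dn x m = sqrt (1 - m * (sn x m)\<^sup>2)"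
  unfolding dn_def by (rule DERIV_imp_deriv[OF am_has_derivative_sqrt])

lemma dn_pos: "0 < dn x m"
  using one_minus_m_sin_squared_pos[OF m_pos m_less_1] by (simp add: dn_eq sn_def)

lemma dn_squared: "(dn x m)\<^sup>2 = 1 - m * (sn x m)\<^sup>2"
  using one_minus_m_sin_squared_pos[OF m_pos m_less_1, of "am x m"] by (simp add: dn_eq sn_def)

lemma sn_squared_add_cn_squared: "(sn x m)\<^sup>2 + (cn x m)\<^sup>2 = 1"
  by (simp add: sn_def cn_def)

lemma am_has_derivative: "((\<lambda>x. am x m) has_real_derivative dn x m) (at x)"
  using am_has_derivative_sqrt by (simp add: dn_eq)

lemma sn_has_derivative: "((\<lambda>x. sn x m) has_real_derivative cn x m * dn x m) (at x)"
  unfolding sn_def cn_def by (auto intro!: derivative_eq_intros am_has_derivative)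

lemma cn_has_derivative: "((\<lambda>x. cn x m) has_real_derivative - sn x m * dn x m) (at x)"
  unfolding sn_def cn_def by (auto intro!: derivative_eq_intros am_has_derivative)

lemma dn_has_derivative: "((\<lambda>x. dn x m) has_real_derivative - m * sn x m * cn x m) (at x)"
proof -
  have "0 < 1 - m * (sn x m)\<^sup>2"
    using one_minus_m_sin_squared_pos[OF m_pos m_less_1] by (simp add: sn_def)
  then have "((\<lambda>x. sqrt (1 - m * (sn x m)\<^sup>2)) has_real_derivative
      inverse (sqrt (1 - m * (sn x m)\<^sup>2)) / 2 * (- m * (2 * sn x m * (cn x m * dn x m)))) (at x)"
    by (intro DERIV_chain2[OF DERIV_real_sqrt]) (auto intro!: derivative_eq_intros sn_has_derivative)
  then show ?thesis
    using dn_pos[of x] by (simp add: dn_eq[symmetric] field_simps)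
qed

lemma sn_0: "sn 0 m = 0" and cn_0: "cn 0 m = 1" and dn_0: "dn 0 m = 1"
proof -
  have "am 0 m = 0"
    using is_amplitude_ellF_inverse unfolding am_eq_ellF_inverse is_amplitude_def by blast
  then show "sn 0 m = 0" "cn 0 m = 1" by (simp_all add: sn_def cn_def)
  then show "dn 0 m = 1" by (simp add: dn_eq)
qed

lemma complexifiable_am: "complexifiable (\<lambda>x. am x m) x"
proof (rule complexifiable_inverse_function)
  let ?F' = "\<lambda>\<phi>. 1 / sqrt (1 - m * (sin \<phi>)\<^sup>2)"
  show "((\<lambda>\<phi>. ellF \<phi> m) has_real_derivative ?F' \<phi>) (at \<phi>)" for \<phi>
    by (rule ellF_has_derivative[OF m_pos m_less_1])
  have pos: "0 < 1 - m * (sin (am x m))\<^sup>2"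
    by (rule one_minus_m_sin_squared_pos[OF m_pos m_less_1])
  then show "complexifiable ?F' (am x m)"
    by (intro complexifiable_intros) simp_all
  show "?F' (am x m) \<noteq> 0" using pos by simp
  show "ellF (am y m) m = y" for y by (rule ellF_am)
  show "isCont (\<lambda>x. am x m) x"
    by (rule DERIV_isCont[OF am_has_derivative])
qed

lemma complexifiable_sn: "complexifiable (\<lambda>x. sn x m) x"
  and complexifiable_cn: "complexifiable (\<lambda>x. cn x m) x"
  unfolding sn_def cn_def by (intro complexifiable_intros complexifiable_am)+

lemma complexifiable_dn: "complexifiable (\<lambda>x. dn x m) x"
  using dn_pos[of x] unfolding dn_eq by (intro complexifiable_intros complexifiable_sn) simp

text \<open>The zeros of \<^const>\<open>sn\<close> are simple, because its derivative \<open>cn * dn\<close> does not vanish there.\<close>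

lemma eventually_sn_nonzero: "\<forall>\<^sub>F y in at x. sn y m \<noteq> 0"
proof (cases "sn x m = 0")
  case True
  then have "cn x m * dn x m \<noteq> 0"
    using sn_squared_add_cn_squared[of x] dn_pos[of x] by auto
  then show ?thesis
    using sn_has_derivative[of x] True
    by (auto simp: has_field_derivative_iff dest!: tendsto_imp_eventually_ne elim!: eventually_mono)
next
  case False
  then show ?thesis
    using DERIV_isCont[OF sn_has_derivative, of x] tendsto_imp_eventually_ne by (auto simp: isCont_def)
qed

lemma abs_sqrt_m_sn_less_1: "\<bar>sqrt m * sn x m\<bar> < 1"
proof -
  have "(sqrt m * sn x m)\<^sup>2 < 1"
    using dn_squared[of x] dn_pos[of x] m_pos
    by (simp add: power_mult_distrib) (metis diff_gt_0_iff_gt zero_less_power)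
  then show ?thesis by (simp add: abs_square_less_1)
qed

lemma sqrt_one_minus_m_sn_squared: "sqrt (1 - (sqrt m * sn x m)\<^sup>2) = dn x m"
  using m_pos by (simp add: power_mult_distrib dn_eq)

text \<open>Jacobi's real transformation. For a parameter above 1 the pendulum oscillates, and the
  arc sine of \<open>sqrt m * sn (x / sqrt m) m\<close>, which stays strictly inside \<open>(- pi / 2, pi / 2)\<close>, solves its
  equation; uniqueness identifies it with the amplitude.\<close>

lemma am_reciprocal_parameter:
  "((\<lambda>x. am x (inverse m)) has_real_derivative cn (x / sqrt m) m) (at x)" (is "?der x")
  "sin (am x (inverse m)) = sqrt m * sn (x / sqrt m) m" (is ?sin)
  "cos (am x (inverse m)) = dn (x / sqrt m) m" (is ?cos)
proof -
  define \<theta> where "\<theta> x = arcsin (sqrt m * sn (x / sqrt m) m)" for x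
  have bounds: "-1 < sqrt m * sn (x / sqrt m) m" "sqrt m * sn (x / sqrt m) m < 1" for x
    using abs_sqrt_m_sn_less_1[of "x / sqrt m"] by linarith+
  then have sin: "sin (\<theta> x) = sqrt m * sn (x / sqrt m) m" for x
    by (simp add: \<theta>_def less_imp_le)
  have cos: "cos (\<theta> x) = dn (x / sqrt m) m" for x
    using bounds[of x] sqrt_one_minus_m_sn_squared by (simp add: \<theta>_def cos_arcsin less_imp_le)
  have der: "(\<theta> has_real_derivative cn (x / sqrt m) m) (at x)" for x
  proof -
    have "(\<theta> has_real_derivative inverse (sqrt (1 - (sqrt m * sn (x / sqrt m) m)\<^sup>2)) *
        (sqrt m * (cn (x / sqrt m) m * dn (x / sqrt m) m * (1 / sqrt m)))) (at x)"
      unfolding \<theta>_def using bounds[of x]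
      by (intro DERIV_chain2[OF DERIV_arcsin] DERIV_cmult DERIV_chain2[OF sn_has_derivative]
          DERIV_cdivide DERIV_ident)
    then show ?thesis
      unfolding sqrt_one_minus_m_sn_squared
      using dn_pos[of "x / sqrt m"] m_pos by (simp add: field_simps)
  qed
  have "((\<lambda>x. cn (x / sqrt m) m) has_real_derivative - inverse m * sin (\<theta> x) * cos (\<theta> x)) (at x)" for x
  proof -
    have "((\<lambda>x. cn (x / sqrt m) m) has_real_derivative
        - sn (x / sqrt m) m * dn (x / sqrt m) m * (1 / sqrt m)) (at x)"
      by (intro DERIV_chain2[OF cn_has_derivative] DERIV_cdivide DERIV_ident)
    moreover have "1 / sqrt m = inverse m * sqrt m"
      using m_pos by (simp add: field_simps)
    ultimately show ?thesis
      unfolding sin cos by (simp add: mult_ac)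
  qed
  then have "is_amplitude (inverse m) \<theta>"
    unfolding is_amplitude_def using der
    by (intro exI[of _ "\<lambda>x. cn (x / sqrt m) m"]) (auto simp: \<theta>_def sn_0 cn_0)
  then have eq: "am x (inverse m) = \<theta> x" for x
    by (rule am_eqI)
  show "?der x" ?sin ?cos
    using der sin cos by (simp_all add: eq)
qed

end

section \<open>The frame equations of a pseudospherical map\<close>

text \<open>The mean value theorem applied first in \<open>x\<close> to the increment in \<open>y\<close>, and then in \<open>y\<close>.\<close>

lemma second_difference_mean_value:
  fixes F Fx Fxy :: "real \<Rightarrow> real \<Rightarrow> real"
  assumes Fx: "\<And>x y. ((\<lambda>x. F x y) has_real_derivative Fx x y) (at x)"
    and Fxy: "\<And>x y. (Fx x has_real_derivative Fxy x y) (at y)"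
    and h: "0 < h"
  obtains \<xi> \<eta> where "a < \<xi>" "\<xi> < a + h" "b < \<eta>" "\<eta> < b + h"
    "F (a + h) (b + h) - F (a + h) b - (F a (b + h) - F a b) = h * (h * Fxy \<xi> \<eta>)"
proof -
  have "\<exists>\<xi>>a. \<xi> < a + h \<and> (F (a + h) (b + h) - F (a + h) b) - (F a (b + h) - F a b)
      = (a + h - a) * (Fx \<xi> (b + h) - Fx \<xi> b)"
    using h by (intro MVT2) (auto intro!: DERIV_diff Fx)
  then obtain \<xi> where \<xi>: "a < \<xi>" "\<xi> < a + h"
    "F (a + h) (b + h) - F (a + h) b - (F a (b + h) - F a b) = h * (Fx \<xi> (b + h) - Fx \<xi> b)"
    by auto
  have "\<exists>\<eta>>b. \<eta> < b + h \<and> Fx \<xi> (b + h) - Fx \<xi> b = (b + h - b) * Fxy \<xi> \<eta>"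
    using h by (intro MVT2) (auto intro!: Fxy)
  then obtain \<eta> where "b < \<eta>" "\<eta> < b + h" "Fx \<xi> (b + h) - Fx \<xi> b = h * Fxy \<xi> \<eta>"
    by auto
  then show thesis
    using \<xi> by (intro that[of \<xi> \<eta>]) auto
qed

text \<open>The second difference over a small square is symmetric in the two variables, so the two mixed
  partial derivatives agree at points arbitrarily close to \<open>(a, b)\<close>. This is the theorem of Schwarz.\<close>

lemma mixed_partials_commute:
  fixes F Fx Fy Fxy Fyx :: "real \<Rightarrow> real \<Rightarrow> real"
  assumes Fx: "\<And>x y. ((\<lambda>x. F x y) has_real_derivative Fx x y) (at x)"
    and Fy: "\<And>x y. (F x has_real_derivative Fy x y) (at y)"
    and Fxy: "\<And>x y. (Fx x has_real_derivative Fxy x y) (at y)"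
    and Fyx: "\<And>x y. ((\<lambda>x. Fy x y) has_real_derivative Fyx x y) (at x)"
    and cont: "isCont (\<lambda>p. Fxy (fst p) (snd p)) (a, b)" "isCont (\<lambda>p. Fyx (fst p) (snd p)) (a, b)"
  shows "Fxy a b = Fyx a b"
proof (rule ccontr)
  define e where "e = \<bar>Fxy a b - Fyx a b\<bar> / 2"
  assume "Fxy a b \<noteq> Fyx a b"
  then have e: "e > 0" by (simp add: e_def)
  obtain d1 where d1: "d1 > 0" "\<And>q. dist q (a, b) < d1 \<Longrightarrow> \<bar>Fxy (fst q) (snd q) - Fxy a b\<bar> < e"
    using cont(1) e unfolding continuous_at_eps_delta by (fastforce simp: dist_real_def)
  obtain d2 where d2: "d2 > 0" "\<And>q. dist q (a, b) < d2 \<Longrightarrow> \<bar>Fyx (fst q) (snd q) - Fyx a b\<bar> < e"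
    using cont(2) e unfolding continuous_at_eps_delta by (fastforce simp: dist_real_def)
  define h where "h = min d1 d2 / 2"
  have h: "h > 0" "2 * h \<le> d1" "2 * h \<le> d2"
    using d1(1) d2(1) by (auto simp: h_def)
  have close: "dist (x, y) (a, b) < 2 * h" if "a < x" "x < a + h" "b < y" "y < b + h" for x y
    using that sqrt_sum_squares_le_sum_abs[of "x - a" "y - b"]
    by (simp add: dist_Pair_Pair dist_real_def)
  obtain \<xi> \<eta> where 1: "a < \<xi>" "\<xi> < a + h" "b < \<eta>" "\<eta> < b + h"
    "F (a + h) (b + h) - F (a + h) b - (F a (b + h) - F a b) = h * (h * Fxy \<xi> \<eta>)"
    using second_difference_mean_value[of F Fx Fxy h, OF Fx Fxy h(1)] by metis
  obtain \<xi>' \<eta>' where 2: "a < \<xi>'" "\<xi>' < a + h" "b < \<eta>'" "\<eta>' < b + h"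
    "F (a + h) (b + h) - F a (b + h) - (F (a + h) b - F a b) = h * (h * Fyx \<xi>' \<eta>')"
    using second_difference_mean_value[of "\<lambda>y x. F x y" "\<lambda>y x. Fy x y" "\<lambda>y x. Fyx x y" h, OF Fy Fyx h(1)]
    by metis
  have "Fxy \<xi> \<eta> = Fyx \<xi>' \<eta>'"
    using 1(5) 2(5) h(1) by (simp add: algebra_simps)
  moreover have "\<bar>Fxy \<xi> \<eta> - Fxy a b\<bar> < e" "\<bar>Fyx \<xi>' \<eta>' - Fyx a b\<bar> < e"
    using d1(2)[of "(\<xi>, \<eta>)"] d2(2)[of "(\<xi>', \<eta>')"] close 1 2 h by fastforce+
  ultimately show False
    unfolding e_def by (auto simp: abs_if field_simps split: if_splits)
qed

lemma has_derivative_along_line: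
  fixes g :: "'a::real_normed_vector \<Rightarrow> 'b::real_inner"
  assumes "(g has_derivative g') (at (p + \<tau> *\<^sub>R w))"
  shows "((\<lambda>\<tau>. g (p + \<tau> *\<^sub>R w) \<bullet> k) has_real_derivative g' w \<bullet> k) (at \<tau>)"
proof -
  have lin: "linear g'"
    using assms has_derivative_linear by blast
  have "((\<lambda>\<tau>. p + \<tau> *\<^sub>R w) has_derivative (\<lambda>h. h *\<^sub>R w)) (at \<tau>)"
    by (auto intro!: derivative_eq_intros)
  then have "((\<lambda>\<tau>. g (p + \<tau> *\<^sub>R w)) has_derivative (\<lambda>h. g' (h *\<^sub>R w))) (at \<tau>)"
    using has_derivative_compose assms by blast
  then have "((\<lambda>\<tau>. g (p + \<tau> *\<^sub>R w) \<bullet> k) has_derivative (\<lambda>h. g' (h *\<^sub>R w) \<bullet> k)) (at \<tau>)"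
    by (rule has_derivative_inner_left)
  moreover have "(\<lambda>h. g' (h *\<^sub>R w) \<bullet> k) = (*) (g' w \<bullet> k)"
    by (auto simp: fun_eq_iff linear_scale[OF lin])
  ultimately show ?thesis
    by (simp add: has_field_derivative_def)
qed

lemma smooth_map_has_derivative:
  assumes "smooth_map g"
  shows "(g has_derivative frechet_derivative g (at p)) (at p)"
proof -
  have "Ck 1 g" using assms by (simp add: smooth_map_def)
  then show ?thesis using frechet_derivative_works by auto
qed

lemma smooth_map_isCont_frechet_derivative:
  assumes "smooth_map g"
  shows "isCont (\<lambda>p. frechet_derivative g (at p) w) p"
proof -
  have "Ck (Suc 0) g" using assms by (simp add: smooth_map_def)
  then show ?thesis by (auto simp: continuous_on_eq_continuous_at)
qed

lemma smooth_map_isCont: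
  assumes "smooth_map g"
  shows "isCont g p"
  using smooth_map_has_derivative[OF assms] has_derivative_continuous by blast

lemma positive_orthonormal_iff_rotation_matrix:
  "positive_orthonormal a b c \<longleftrightarrow> rotation_matrix (vector [a, b, c])"
proof -
  let ?E = "vector [a, b, c] :: real^3^3"
  have "row 1 ?E = a" "row 2 ?E = b" "row 3 ?E = c"
    by (simp_all add: row_def vector_3)
  then have "orthogonal_matrix ?E \<longleftrightarrow> norm a = 1 \<and> norm b = 1 \<and> norm c = 1 \<and> a \<bullet> b = 0 \<and> a \<bullet> c = 0 \<and> b \<bullet> c = 0"
    by (auto simp: orthogonal_matrix_orthonormal_rows forall_3 orthogonal_def inner_commute)
  moreover have "orthogonal_matrix ?E \<Longrightarrow> det ?E > 0 \<longleftrightarrow> det ?E = 1"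
    using det_orthogonal_matrix[of ?E] by auto
  ultimately show ?thesis
    unfolding positive_orthonormal_def rotation_matrix_def by blast
qed

lemma positive_orthonormal_expansion:
  assumes "positive_orthonormal a b c"
  shows "x = (x \<bullet> a) *\<^sub>R a + (x \<bullet> b) *\<^sub>R b + (x \<bullet> c) *\<^sub>R c"
proof -
  let ?E = "vector [a, b, c] :: real^3^3"
  have "transpose ?E ** ?E = mat 1"
    using assms unfolding positive_orthonormal_iff_rotation_matrix rotation_matrix_def orthogonal_matrix by blast
  then have "x = transpose ?E *v (?E *v x)"
    by (simp add: matrix_vector_mul_assoc)
  also have "\<dots> = (x \<bullet> a) *\<^sub>R a + (x \<bullet> b) *\<^sub>R b + (x \<bullet> c) *\<^sub>R c"
    by (simp add: vec_eq_iff matrix_vector_mult_def transpose_def sum_3 vector_3 inner_vec_def algebra_simps)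
  finally show ?thesis .
qed

text \<open>Differentiating a constant inner product; for an orthonormal frame this is the skew symmetry of
  the connection matrix.\<close>

lemma inner_eq_imp_frechet_derivative_inner:
  fixes e e' :: "'a::euclidean_space \<Rightarrow> 'b::real_inner"
  assumes "smooth_map e" "smooth_map e'" "\<And>p. e p \<bullet> e' p = c"
  shows "frechet_derivative e (at p) w \<bullet> e' p + e p \<bullet> frechet_derivative e' (at p) w = 0"
proof -
  have "((\<lambda>q. e q \<bullet> e' q) has_derivative
      (\<lambda>h. e p \<bullet> frechet_derivative e' (at p) h + frechet_derivative e (at p) h \<bullet> e' p)) (at p)"
    by (intro has_derivative_inner smooth_map_has_derivative assms)
  moreover have "((\<lambda>q. e q \<bullet> e' q) has_derivative (\<lambda>h. 0)) (at p)"
    using assms(3) by simp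
  ultimately have "(\<lambda>h. e p \<bullet> frechet_derivative e' (at p) h + frechet_derivative e (at p) h \<bullet> e' p) = (\<lambda>h. 0)"
    by (rule has_derivative_unique)
  then show ?thesis
    by (metis add.commute)
qed

lemma linear_prod_expand:
  fixes g :: "real \<times> real \<Rightarrow> 'b::real_vector"
  assumes "linear g"
  shows "g h = fst h *\<^sub>R g (1, 0) + snd h *\<^sub>R g (0, 1)"
proof -
  have "h = fst h *\<^sub>R (1, 0) + snd h *\<^sub>R (0, 1)"
    by (simp add: prod_eq_iff)
  then show ?thesis
    by (metis assms linear_add linear_scale)
qed

text \<open>All coefficients of the derivatives of the frame are forced by the angle. The components along
  \<open>e3\<close> are the second fundamental form divided by \<open>cos \<alpha>\<close> or \<open>sin \<alpha>\<close>; the remaining ones follow from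
  the symmetry of the second derivatives of \<open>f\<close>, that is, from
  \<open>\<partial>\<^sub>t (cos \<alpha> e1) = \<partial>\<^sub>s (sin \<alpha> e2)\<close>. Where the map is singular, \<open>sin \<alpha> = 0\<close>, the division is not
  possible, but the equations extend by continuity from the dense set \<open>sin \<alpha> \<noteq> 0\<close>.\<close>

lemma pseudospherical_frame_equations:
  fixes \<alpha> \<alpha>s \<alpha>t :: "real \<times> real \<Rightarrow> real"
  assumes f: "pseudospherical_map \<phi> f"
    and \<phi>: "\<And>p. \<phi> p / 2 = \<alpha> p"
    and \<alpha>_s: "\<And>s t. ((\<lambda>s. \<alpha> (s, t)) has_real_derivative \<alpha>s (s, t)) (at s)"
    and \<alpha>_t: "\<And>s t. ((\<lambda>t. \<alpha> (s, t)) has_real_derivative \<alpha>t (s, t)) (at t)"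
    and \<alpha>_cont: "\<And>p. isCont \<alpha> p" "\<And>p. isCont \<alpha>s p" "\<And>p. isCont \<alpha>t p"
    and cos_nz: "\<And>p. cos (\<alpha> p) \<noteq> 0"
    and sin_nz: "\<And>p. \<exists>\<^sub>F q in at p. sin (\<alpha> q) \<noteq> 0"
  obtains e1 e2 e3 where
    "\<And>p. positive_orthonormal (e1 p) (e2 p) (e3 p)"
    "\<And>p. (f has_derivative (\<lambda>h. (fst h * cos (\<alpha> p)) *\<^sub>R e1 p + (snd h * sin (\<alpha> p)) *\<^sub>R e2 p)) (at p)"
    "\<And>p. (e1 has_derivative (\<lambda>h. (fst h * \<alpha>t p + snd h * \<alpha>s p) *\<^sub>R e2 p
        + (fst h * sin (\<alpha> p)) *\<^sub>R e3 p)) (at p)"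
    "\<And>p. (e2 has_derivative (\<lambda>h. - (fst h * \<alpha>t p + snd h * \<alpha>s p) *\<^sub>R e1 p
        - (snd h * cos (\<alpha> p)) *\<^sub>R e3 p)) (at p)"
    "\<And>p. (e3 has_derivative (\<lambda>h. - (fst h * sin (\<alpha> p)) *\<^sub>R e1 p
        + (snd h * cos (\<alpha> p)) *\<^sub>R e2 p)) (at p)"
proof -
  have smooth_f: "smooth_map f"
    using f unfolding pseudospherical_map_def by blast
  obtain e1 e2 e3 where smooth: "smooth_map e1" "smooth_map e2" "smooth_map e3"
    and all: "\<forall>p. positive_orthonormal (e1 p) (e2 p) (e3 p) \<and>
          frechet_derivative f (at p) (1, 0) = cos (\<phi> p / 2) *\<^sub>R e1 p \<and>
          frechet_derivative f (at p) (0, 1) = sin (\<phi> p / 2) *\<^sub>R e2 p \<and>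
          (\<forall>v w. - (frechet_derivative f (at p) v \<bullet> frechet_derivative e3 (at p) w) =
             cos (\<phi> p / 2) * sin (\<phi> p / 2) * (fst v * fst w - snd v * snd w))"
    using f unfolding pseudospherical_map_def by blast
  have orth: "positive_orthonormal (e1 p) (e2 p) (e3 p)" for p
    using all by blast
  have f_s: "frechet_derivative f (at p) (1, 0) = cos (\<alpha> p) *\<^sub>R e1 p"
    and f_t: "frechet_derivative f (at p) (0, 1) = sin (\<alpha> p) *\<^sub>R e2 p"
    and second: "- (frechet_derivative f (at p) v \<bullet> frechet_derivative e3 (at p) w) =
             cos (\<alpha> p) * sin (\<alpha> p) * (fst v * fst w - snd v * snd w)" for p v w
    using all unfolding \<phi> by blast+
  have orthonormal: "e1 p \<bullet> e1 p = 1" "e2 p \<bullet> e2 p = 1" "e3 p \<bullet> e3 p = 1"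
    "e1 p \<bullet> e2 p = 0" "e1 p \<bullet> e3 p = 0" "e2 p \<bullet> e3 p = 0" for p
    using orth[of p] by (auto simp: positive_orthonormal_def norm_eq_1)
  define A1 A2 A3 B1 B2 B3 where
    "A1 p = frechet_derivative e1 (at p) (1, 0)" and "A2 p = frechet_derivative e2 (at p) (1, 0)" and
    "A3 p = frechet_derivative e3 (at p) (1, 0)" and "B1 p = frechet_derivative e1 (at p) (0, 1)" and
    "B2 p = frechet_derivative e2 (at p) (0, 1)" and "B3 p = frechet_derivative e3 (at p) (0, 1)" for p
  note AB = A1_def A2_def A3_def B1_def B2_def B3_def
  have skewA: "A1 p \<bullet> e1 p = 0" "A2 p \<bullet> e2 p = 0" "A3 p \<bullet> e3 p = 0"
      "A1 p \<bullet> e2 p = - (A2 p \<bullet> e1 p)" "A1 p \<bullet> e3 p = - (A3 p \<bullet> e1 p)" "A2 p \<bullet> e3 p = - (A3 p \<bullet> e2 p)"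
    and skewB: "B1 p \<bullet> e1 p = 0" "B2 p \<bullet> e2 p = 0" "B3 p \<bullet> e3 p = 0"
      "B1 p \<bullet> e2 p = - (B2 p \<bullet> e1 p)" "B1 p \<bullet> e3 p = - (B3 p \<bullet> e1 p)" "B2 p \<bullet> e3 p = - (B3 p \<bullet> e2 p)" for p
    using inner_eq_imp_frechet_derivative_inner[OF smooth(1) smooth(1) orthonormal(1), of p]
      inner_eq_imp_frechet_derivative_inner[OF smooth(2) smooth(2) orthonormal(2), of p]
      inner_eq_imp_frechet_derivative_inner[OF smooth(3) smooth(3) orthonormal(3), of p]
      inner_eq_imp_frechet_derivative_inner[OF smooth(1) smooth(2) orthonormal(4), of p]
      inner_eq_imp_frechet_derivative_inner[OF smooth(1) smooth(3) orthonormal(5), of p]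
      inner_eq_imp_frechet_derivative_inner[OF smooth(2) smooth(3) orthonormal(6), of p]
    unfolding AB by (simp_all add: inner_commute eq_neg_iff_add_eq_0)
  have isCont_e: "isCont e1 p" "isCont e2 p" "isCont e3 p"
    and isCont_A: "isCont A1 p" "isCont A2 p" "isCont A3 p"
    and isCont_B: "isCont B1 p" "isCont B2 p" "isCont B3 p" for p
    unfolding AB using smooth smooth_map_isCont smooth_map_isCont_frechet_derivative by blast+

  have line_s: "((\<lambda>s. g (s, t) \<bullet> k) has_real_derivative frechet_derivative g (at (s, t)) (1, 0) \<bullet> k) (at s)"
    and line_t: "((\<lambda>t. g (s, t) \<bullet> k) has_real_derivative frechet_derivative g (at (s, t)) (0, 1) \<bullet> k) (at t)"
    if g: "smooth_map g" for g :: "real \<times> real \<Rightarrow> real^3" and s t k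
    using has_derivative_along_line[of g "frechet_derivative g (at (s, t))" "(0, t)" s "(1, 0)" k]
      has_derivative_along_line[of g "frechet_derivative g (at (s, t))" "(s, 0)" t "(0, 1)" k]
      smooth_map_has_derivative[OF g, of "(s, t)"] by simp_all
  have compatibility: "- sin (\<alpha> p) * \<alpha>t p * (e1 p \<bullet> k) + cos (\<alpha> p) * (B1 p \<bullet> k)
      = cos (\<alpha> p) * \<alpha>s p * (e2 p \<bullet> k) + sin (\<alpha> p) * (A2 p \<bullet> k)" for p k
  proof -
    obtain s t where p: "p = (s, t)" by force
    have "- sin (\<alpha> (s, t)) * \<alpha>t (s, t) * (e1 (s, t) \<bullet> k) + cos (\<alpha> (s, t)) * (B1 (s, t) \<bullet> k)
      = cos (\<alpha> (s, t)) * \<alpha>s (s, t) * (e2 (s, t) \<bullet> k) + sin (\<alpha> (s, t)) * (A2 (s, t) \<bullet> k)"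
    proof (rule mixed_partials_commute[where F = "\<lambda>s t. f (s, t) \<bullet> k"
          and Fx = "\<lambda>s t. cos (\<alpha> (s, t)) * (e1 (s, t) \<bullet> k)" and Fy = "\<lambda>s t. sin (\<alpha> (s, t)) * (e2 (s, t) \<bullet> k)"
          and Fxy = "\<lambda>s t. - sin (\<alpha> (s, t)) * \<alpha>t (s, t) * (e1 (s, t) \<bullet> k) + cos (\<alpha> (s, t)) * (B1 (s, t) \<bullet> k)"
          and Fyx = "\<lambda>s t. cos (\<alpha> (s, t)) * \<alpha>s (s, t) * (e2 (s, t) \<bullet> k) + sin (\<alpha> (s, t)) * (A2 (s, t) \<bullet> k)"])
      fix s t
      show "((\<lambda>s. f (s, t) \<bullet> k) has_real_derivative cos (\<alpha> (s, t)) * (e1 (s, t) \<bullet> k)) (at s)"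
        using line_s[OF smooth_f] by (simp add: f_s)
      show "((\<lambda>t. f (s, t) \<bullet> k) has_real_derivative sin (\<alpha> (s, t)) * (e2 (s, t) \<bullet> k)) (at t)"
        using line_t[OF smooth_f] by (simp add: f_t)
      show "((\<lambda>t. cos (\<alpha> (s, t)) * (e1 (s, t) \<bullet> k)) has_real_derivative
          - sin (\<alpha> (s, t)) * \<alpha>t (s, t) * (e1 (s, t) \<bullet> k) + cos (\<alpha> (s, t)) * (B1 (s, t) \<bullet> k)) (at t)"
        unfolding AB by (rule derivative_eq_intros line_t[OF smooth(1)] \<alpha>_t refl)+ (simp add: algebra_simps)
      show "((\<lambda>s. sin (\<alpha> (s, t)) * (e2 (s, t) \<bullet> k)) has_real_derivative
          cos (\<alpha> (s, t)) * \<alpha>s (s, t) * (e2 (s, t) \<bullet> k) + sin (\<alpha> (s, t)) * (A2 (s, t) \<bullet> k)) (at s)"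
        unfolding AB by (rule derivative_eq_intros line_s[OF smooth(2)] \<alpha>_s refl)+ (simp add: algebra_simps)
    qed (simp_all, (intro continuous_intros isCont_e isCont_A isCont_B \<alpha>_cont)+)
    then show ?thesis unfolding p .
  qed
  \<comment> \<open>division by \<open>sin \<alpha>\<close>, across the singular set by continuity\<close>
  have cancel_sin: "g p = 0" if "\<And>q. sin (\<alpha> q) * g q = 0" "\<And>q. isCont g q" for g :: "real \<times> real \<Rightarrow> real" and p
  proof (rule ccontr)
    assume "g p \<noteq> 0"
    then have "\<forall>\<^sub>F q in at p. g q \<noteq> 0"
      using that(2)[of p] tendsto_imp_eventually_ne unfolding isCont_def by blast
    then have "\<forall>\<^sub>F q in at p. sin (\<alpha> q) = 0"
      by eventually_elim (use that(1) in auto)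
    then show False
      using sin_nz[of p] by (simp add: frequently_def)
  qed
  have B1e2: "B1 p \<bullet> e2 p = \<alpha>s p" for p
    using compatibility[of p "e2 p"] cos_nz[of p] by (simp add: orthonormal skewA)
  then have B2e1: "B2 p \<bullet> e1 p = - \<alpha>s p" for p
    using skewB(4) by (metis add.inverse_inverse)
  have A2e1: "A2 p \<bullet> e1 p = - \<alpha>t p" for p
  proof -
    have "A2 p \<bullet> e1 p + \<alpha>t p = 0"
    proof (rule cancel_sin[of "\<lambda>p. A2 p \<bullet> e1 p + \<alpha>t p"])
      show "sin (\<alpha> q) * (A2 q \<bullet> e1 q + \<alpha>t q) = 0" for q
        using compatibility[of q "e1 q"] by (simp add: orthonormal skewB inner_commute[of "e2 q"] algebra_simps)
    qed (intro continuous_intros isCont_e isCont_A \<alpha>_cont)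
    then show ?thesis by simp
  qed
  have A3e1: "A3 p \<bullet> e1 p = - sin (\<alpha> p)" for p
  proof -
    have "cos (\<alpha> p) * (A3 p \<bullet> e1 p + sin (\<alpha> p)) = 0"
      using second[of p "(1, 0)" "(1, 0)"] by (simp add: f_s A3_def inner_commute algebra_simps)
    then show ?thesis
      using cos_nz[of p] by (simp add: eq_neg_iff_add_eq_0)
  qed
  have B3e1: "B3 p \<bullet> e1 p = 0" for p
    using second[of p "(1, 0)" "(0, 1)"] cos_nz[of p] by (simp add: f_s B3_def inner_commute)
  have A3e2: "A3 p \<bullet> e2 p = 0" for p
  proof (rule cancel_sin[of "\<lambda>p. A3 p \<bullet> e2 p"])
    show "sin (\<alpha> q) * (A3 q \<bullet> e2 q) = 0" for q
      using second[of q "(0, 1)" "(1, 0)"] by (simp add: f_t A3_def inner_commute)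
  qed (intro continuous_intros isCont_e isCont_A)
  have B3e2: "B3 p \<bullet> e2 p = cos (\<alpha> p)" for p
  proof -
    have "B3 p \<bullet> e2 p - cos (\<alpha> p) = 0"
    proof (rule cancel_sin[of "\<lambda>p. B3 p \<bullet> e2 p - cos (\<alpha> p)"])
      show "sin (\<alpha> q) * (B3 q \<bullet> e2 q - cos (\<alpha> q)) = 0" for q
        using second[of q "(0, 1)" "(0, 1)"] by (simp add: f_t B3_def inner_commute algebra_simps)
    qed (intro continuous_intros isCont_e isCont_B \<alpha>_cont)
    then show ?thesis by simp
  qed
  have A: "A1 p = \<alpha>t p *\<^sub>R e2 p + sin (\<alpha> p) *\<^sub>R e3 p" "A2 p = - \<alpha>t p *\<^sub>R e1 p" "A3 p = - sin (\<alpha> p) *\<^sub>R e1 p"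
    and B: "B1 p = \<alpha>s p *\<^sub>R e2 p" "B2 p = - \<alpha>s p *\<^sub>R e1 p - cos (\<alpha> p) *\<^sub>R e3 p" "B3 p = cos (\<alpha> p) *\<^sub>R e2 p" for p
    using positive_orthonormal_expansion[OF orth[of p], of "A1 p"]
      positive_orthonormal_expansion[OF orth[of p], of "A2 p"]
      positive_orthonormal_expansion[OF orth[of p], of "A3 p"]
      positive_orthonormal_expansion[OF orth[of p], of "B1 p"]
      positive_orthonormal_expansion[OF orth[of p], of "B2 p"]
      positive_orthonormal_expansion[OF orth[of p], of "B3 p"]
    using skewA[of p] skewB(1-3,5,6)[of p] B2e1[of p] A2e1[of p] B1e2[of p] A3e1[of p] A3e2[of p] B3e1[of p] B3e2[of p]
    by simp_all
  have split: "frechet_derivative g (at p) h = fst h *\<^sub>R frechet_derivative g (at p) (1, 0)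
      + snd h *\<^sub>R frechet_derivative g (at p) (0, 1)"
    if "smooth_map g" for g :: "real \<times> real \<Rightarrow> real^3" and p h
    by (rule linear_prod_expand[OF has_derivative_linear[OF smooth_map_has_derivative[OF that]]])
  show thesis
  proof (rule that[of e1 e2 e3])
    fix p
    show "positive_orthonormal (e1 p) (e2 p) (e3 p)" by (rule orth)
    show "(f has_derivative (\<lambda>h. (fst h * cos (\<alpha> p)) *\<^sub>R e1 p + (snd h * sin (\<alpha> p)) *\<^sub>R e2 p)) (at p)"
      using smooth_map_has_derivative[OF smooth_f, of p] by (subst (asm) split[OF smooth_f, abs_def]) (simp add: f_s f_t)
    show "(e1 has_derivative (\<lambda>h. (fst h * \<alpha>t p + snd h * \<alpha>s p) *\<^sub>R e2 p
        + (fst h * sin (\<alpha> p)) *\<^sub>R e3 p)) (at p)"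
      using smooth_map_has_derivative[OF smooth(1), of p]
      by (subst (asm) split[OF smooth(1), abs_def]) (simp add: A B AB[symmetric] algebra_simps)
    show "(e2 has_derivative (\<lambda>h. - (fst h * \<alpha>t p + snd h * \<alpha>s p) *\<^sub>R e1 p
        - (snd h * cos (\<alpha> p)) *\<^sub>R e3 p)) (at p)"
      using smooth_map_has_derivative[OF smooth(2), of p]
      by (subst (asm) split[OF smooth(2), abs_def]) (simp add: A B AB[symmetric] algebra_simps)
    show "(e3 has_derivative (\<lambda>h. - (fst h * sin (\<alpha> p)) *\<^sub>R e1 p
        + (snd h * cos (\<alpha> p)) *\<^sub>R e2 p)) (at p)"
      using smooth_map_has_derivative[OF smooth(3), of p]
      by (subst (asm) split[OF smooth(3), abs_def]) (simp add: A B AB[symmetric] algebra_simps)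
  qed
qed

section \<open>The profile functions of the helicoid\<close>

lemma ellPi_am_has_derivative:
  assumes "0 < m" "m < 1" "n \<le> 0"
  shows "((\<lambda>u. ellPi n (am u m) m) has_real_derivative 1 / (1 - n * (sn u m)\<^sup>2)) (at u)"
proof -
  interpret elliptic_parameter m by unfold_locales (use assms in auto)
  have n_pos: "1 - n * (sin \<theta>)\<^sup>2 > 0" for \<theta>
    using mult_nonpos_nonneg[OF assms(3), of "(sin \<theta>)\<^sup>2"] by simp
  have "((\<lambda>\<phi>. ellPi n \<phi> m) has_real_derivative
      1 / ((1 - n * (sin \<phi>)\<^sup>2) * sqrt (1 - m * (sin \<phi>)\<^sup>2))) (at \<phi>)" for \<phi>
    unfolding ellPi_def
    by (rule interval_lebesgue_integral_has_derivative)
      (intro continuous_intros ballI,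
        use one_minus_m_sin_squared_pos[OF assms(1,2)] n_pos in \<open>simp add: less_le\<close>)
  then have "((\<lambda>u. ellPi n (am u m) m) has_real_derivative
      1 / ((1 - n * (sin (am u m))\<^sup>2) * sqrt (1 - m * (sin (am u m))\<^sup>2)) * dn u m) (at u)"
    using am_has_derivative by (rule DERIV_chain2)
  then show ?thesis
    using dn_pos[of u] by (simp add: sn_def dn_eq)
qed

lemma ellE_am_has_derivative:
  assumes "0 < m" "m < 1"
  shows "((\<lambda>u. ellE (am u m) m) has_real_derivative (dn u m)\<^sup>2) (at u)"
proof -
  interpret elliptic_parameter m by unfold_locales (use assms in auto)
  have "((\<lambda>\<phi>. ellE \<phi> m) has_real_derivative sqrt (1 - m * (sin \<phi>)\<^sup>2)) (at \<phi>)" for \<phi>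
    unfolding ellE_def by (rule interval_lebesgue_integral_has_derivative) (intro continuous_intros)
  then have "((\<lambda>u. ellE (am u m) m) has_real_derivative sqrt (1 - m * (sin (am u m))\<^sup>2) * dn u m) (at u)"
    using am_has_derivative by (rule DERIV_chain2)
  then show ?thesis
    by (simp add: sn_def dn_eq power2_eq_square)
qed

locale helicoid = elliptic_parameter +
  fixes r :: real
  assumes r_pos: "0 < r"
begin

text \<open>The square roots from which the parametrization is built; \<open>k\<close> is the modulus.\<close>

definition k :: real where "k = sqrt m"
definition w :: real where "w = sqrt (m + (sinh r)\<^sup>2)"
definition y :: "real \<Rightarrow> real" where "y u = sqrt (m * (sn u m)\<^sup>2 + (sinh r)\<^sup>2)"

lemma sinh_r_pos: "0 < sinh r" using r_pos by simp

lemma cosh_r_squared: "(cosh r)\<^sup>2 = 1 + (sinh r)\<^sup>2" by (simp add: cosh_square_eq)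

lemma k_squared: "k\<^sup>2 = m" using m_pos by (simp add: k_def)

lemma w_squared: "w\<^sup>2 = m + (sinh r)\<^sup>2" using m_pos by (simp add: w_def)

lemma w_pos: "0 < w" using m_pos by (simp add: w_def add_pos_nonneg)

lemma y_squared: "(y u)\<^sup>2 = m * (sn u m)\<^sup>2 + (sinh r)\<^sup>2" using m_pos by (simp add: y_def)

lemma y_pos: "0 < y u" using m_pos sinh_r_pos by (simp add: y_def add_nonneg_pos)

lemma psi_has_derivative:
  "(psi m r has_real_derivative - (w * (cosh r * sinh r) / (y u)\<^sup>2)) (at u)"
proof -
  have nonpos: "- m / (sinh r)\<^sup>2 \<le> 0" using m_pos by simp
  have "(psi m r has_real_derivative
      w * (cosh r / sinh r) * (0 - 1 / (1 - (- m / (sinh r)\<^sup>2) * (sn u m)\<^sup>2))) (at u)"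
    unfolding psi_def[abs_def] w_def
    by (intro DERIV_cmult DERIV_diff DERIV_const ellPi_am_has_derivative[OF m_pos m_less_1 nonpos])
  moreover have "1 - (- m / (sinh r)\<^sup>2) * (sn u m)\<^sup>2 = (y u)\<^sup>2 / (sinh r)\<^sup>2"
    using sinh_r_pos by (simp add: y_squared field_simps)
  moreover have "w * (cosh r / sinh r) * (0 - 1 / ((y u)\<^sup>2 / (sinh r)\<^sup>2)) = - (w * (cosh r * sinh r) / (y u)\<^sup>2)"
    using sinh_r_pos y_pos[of u] by (simp add: field_simps power2_eq_square)
  ultimately show ?thesis by simp
qed

lemma zeta_has_derivative: "(zeta m r has_real_derivative (y u)\<^sup>2 / w) (at u)"
proof -
  have "(zeta m r has_real_derivative 1 / w * (0 + (cosh r)\<^sup>2 * (1 - 0) - (dn u m)\<^sup>2)) (at u)"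
    unfolding zeta_def[abs_def] w_def
    by (intro DERIV_cmult DERIV_diff DERIV_add DERIV_const DERIV_ident ellE_am_has_derivative m_pos m_less_1)
  then show ?thesis
    by (simp add: cosh_r_squared dn_squared y_squared add.commute)
qed

lemma y_has_derivative: "(y has_real_derivative m * sn u m * cn u m * dn u m / y u) (at u)"
proof -
  have "0 < m * (sn u m)\<^sup>2 + (sinh r)\<^sup>2"
    using y_pos[of u] y_squared[of u] by (metis zero_less_power)
  then have "(y has_real_derivative inverse (y u) / 2 * (m * (2 * sn u m * (cn u m * dn u m)))) (at u)"
    unfolding y_def by (intro DERIV_chain2[OF DERIV_real_sqrt]) (auto intro!: derivative_eq_intros sn_has_derivative)
  then show ?thesis
    by (simp add: field_simps)
qed

lemma complexifiable_y: "complexifiable y x"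
  unfolding y_def[abs_def] using y_pos[of x]
  by (intro complexifiable_intros complexifiable_sn) (simp add: y_def)

lemma complexifiable_psi: "complexifiable (psi m r) x"
proof (rule complexifiable_primitive)
  show "(psi m r has_real_derivative - (w * (cosh r * sinh r) / (y u)\<^sup>2)) (at u)" for u
    by (rule psi_has_derivative)
  show "complexifiable (\<lambda>u. - (w * (cosh r * sinh r) / (y u)\<^sup>2)) x"
    by (intro complexifiable_intros complexifiable_y) (use y_pos[of x] in simp)
qed

lemma complexifiable_zeta: "complexifiable (zeta m r) x"
proof (rule complexifiable_primitive)
  show "(zeta m r has_real_derivative (y u)\<^sup>2 / w) (at u)" for u
    by (rule zeta_has_derivative)
  show "complexifiable (\<lambda>u. (y u)\<^sup>2 / w) x"
    by (intro complexifiable_intros complexifiable_y) (use w_pos in simp)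
qed

text \<open>In the products \<open>\<xi> q\<^sup>1\<close> and \<open>\<xi> q\<^sup>2\<close> the powers of \<open>sn\<close> cancel. What remains is regular everywhere
  and is the analytic extension. The names say that these will be the coordinates of the surface in
  the rotating frame introduced below.\<close>

definition radial_coord :: "real \<Rightarrow> real" where "radial_coord u = - k * sn u m * dn u m / (w * y u)"
definition transverse_coord :: "real \<Rightarrow> real" where "transverse_coord u = k * cosh r * sinh r * cn u m / (w\<^sup>2 * y u)"

lemma complexifiable_radial_coord: "complexifiable radial_coord x"
  unfolding radial_coord_def[abs_def] using y_pos[of x] w_pos
  by (intro complexifiable_intros complexifiable_y complexifiable_sn complexifiable_dn) simp

lemma complexifiable_transverse_coord: "complexifiable transverse_coord x"
  unfolding transverse_coord_def[abs_def] using y_pos[of x] w_pos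
  by (intro complexifiable_intros complexifiable_y complexifiable_cn) simp

lemma islimpt_sn_nonzero: "x islimpt {u. sn u m \<noteq> 0}"
proof -
  have "\<exists>\<^sub>F y in at x. y \<in> {u. sn u m \<noteq> 0}"
    using eventually_sn_nonzero[of x] by (intro eventually_frequently) auto
  then show ?thesis by (simp add: islimpt_iff_eventually frequently_def)
qed

lemma xi_q1_eq: "xi_q1 m r = radial_coord"
  unfolding xi_q1_def
proof (rule analytic_extension_eqI)
  show "real_analytic radial_coord" by (rule complexifiable_imp_real_analytic[OF complexifiable_radial_coord])
  show "x islimpt {u. sn u m \<noteq> 0}" for x by (rule islimpt_sn_nonzero)
  fix u assume "u \<in> {u. sn u m \<noteq> 0}"
  then show "radial_coord u = xi m r u * q1 m r u"
    using y_pos[of u] w_pos unfolding radial_coord_def xi_def q1_def k_def[symmetric] w_def[symmetric] y_def[symmetric] y_squared[symmetric]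
    by (simp add: field_simps power2_eq_square)
qed

lemma xi_q2_eq: "xi_q2 m r = transverse_coord"
  unfolding xi_q2_def
proof (rule analytic_extension_eqI)
  show "real_analytic transverse_coord" by (rule complexifiable_imp_real_analytic[OF complexifiable_transverse_coord])
  show "x islimpt {u. sn u m \<noteq> 0}" for x by (rule islimpt_sn_nonzero)
  fix u assume "u \<in> {u. sn u m \<noteq> 0}"
  then show "transverse_coord u = xi m r u * q2 m r u"
    using y_pos[of u] w_pos dn_pos[of u] unfolding transverse_coord_def xi_def q2_def k_def[symmetric] w_squared[symmetric] y_def[symmetric] y_squared[symmetric]
    by (simp add: field_simps power2_eq_square)
qed

lemma real_analytic2_f_tilde: "real_analytic2 (f_tilde m r)"
proof -
  have an: "real_analytic (x_tilde m r)" "real_analytic (y_tilde m r)" "real_analytic (z_tilde m r)"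
    unfolding x_tilde_def[abs_def] y_tilde_def[abs_def] z_tilde_def[abs_def] xi_q1_eq xi_q2_eq
    by (intro complexifiable_imp_real_analytic complexifiable_intros complexifiable_psi complexifiable_radial_coord
        complexifiable_transverse_coord complexifiable_zeta)+
  have trig: "real_analytic (\<lambda>v. cos (2 * pi * v))" "real_analytic (\<lambda>v. sin (2 * pi * v))" "real_analytic (\<lambda>v. - sin (2 * pi * v))"
    "real_analytic (\<lambda>v. rho m r * v)" "real_analytic (\<lambda>_. 1)"
    by (intro complexifiable_imp_real_analytic complexifiable_intros)+
  define F where "F a b i = (\<lambda>(u, v). (a u * b v) *\<^sub>R (axis i 1 :: real^3))" for a b :: "real \<Rightarrow> real" and i
  have F: "real_analytic2 (F a b i)" if "real_analytic a" "real_analytic b" for a b i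
    unfolding F_def using that by (rule real_analytic2_product)
  have "f_tilde m r = (\<lambda>z. F (x_tilde m r) (\<lambda>v. cos (2 * pi * v)) 1 z + F (y_tilde m r) (\<lambda>v. - sin (2 * pi * v)) 1 z
      + F (x_tilde m r) (\<lambda>v. sin (2 * pi * v)) 2 z + F (y_tilde m r) (\<lambda>v. cos (2 * pi * v)) 2 z
      + F (z_tilde m r) (\<lambda>_. 1) 3 z + F (\<lambda>_. 1) (\<lambda>v. rho m r * v) 3 z)"
    unfolding f_tilde_def by (simp add: F_def fun_eq_iff vec_eq_iff forall_3 vector_3 axis_def mult.commute)
  then show ?thesis
    by (simp only:) (intro real_analytic2_add F an trig)
qed

end

section \<open>Explicit integration of the frame equations\<close>

text \<open>The quotient rule for \<open>N / (w * y)\<close> when \<open>y * y' = q\<close>, arranged so that only a polynomial identity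
  between numerators has to be supplied.\<close>

lemma quotient_rule_rescaled:
  fixes N N' T w y :: real
  assumes "w \<noteq> 0" "y \<noteq> 0" and "N' * y\<^sup>2 - N * q = w\<^sup>2 * (l * y\<^sup>2 - j) * T"
  shows "(N' * (w * y) - N * (w * (q / y))) / ((w * y) * (w * y)) = (w * l - w * j / y\<^sup>2) * (T / y)"
proof -
  have "(N' * (w * y) - N * (w * (q / y))) / ((w * y) * (w * y)) = (N' * y\<^sup>2 - N * q) / (w * y ^ 3)"
    using assms(1,2) by (simp add: field_simps power2_eq_square power3_eq_cube)
  also have "\<dots> = (w * l - w * j / y\<^sup>2) * (T / y)"
    using assms(1,2) unfolding assms(3) by (simp add: field_simps power2_eq_square power3_eq_cube)
  finally show ?thesis .
qed

text \<open>The polynomial identities behind the explicit integration of the frame equations, at one point.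
  Here \<open>s, c, d\<close> are the values of \<open>sn, cn, dn\<close>, \<open>k\<close> is the modulus, \<open>sh, ch\<close> are \<open>sinh r, cosh r\<close>,
  \<open>(a, b)\<close> is a direction in the \<open>(s, t)\<close> plane and \<open>\<kappa>, l\<close> are the derivatives in that direction of
  \<open>sinh r * s + cosh r * t\<close> and \<open>cosh r * s + sinh r * t\<close>. The components of the
  frame along a fixed vector are \<open>x1, x2, x3\<close>, and the frame equations give them the derivatives
  \<open>x1', x2', x3'\<close> in that direction.\<close>

locale frame_point =
  fixes s c d k sh ch \<kappa> l a b x1 x2 x3 x1' x2' x3' :: real
  assumes squares: "c\<^sup>2 = 1 - s\<^sup>2" "d\<^sup>2 = 1 - k\<^sup>2 * s\<^sup>2" "ch\<^sup>2 = 1 + sh\<^sup>2"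
    and directions: "\<kappa> = sh * a + ch * b" "l = ch * a + sh * b"
    and x1': "x1' = - k * c * l * x2 - a * k * s * x3"
    and x2': "x2' = k * c * l * x1 - b * d * x3"
    and x3': "x3' = a * k * s * x1 + b * d * x2"
begin

text \<open>Numerators of the radial, transverse and axial vector, and, primed, their derivatives in the direction \<open>(a, b)\<close>.\<close>

abbreviation "N_radial \<equiv> k * sh * c * d * x1 + k\<^sup>2 * ch * c * s * x2 + (k\<^sup>2 * s\<^sup>2 + sh\<^sup>2) * x3"
abbreviation "N_transverse \<equiv> k * ch * s * x1 - sh * d * x2"
abbreviation "N_axial \<equiv> sh * d * x1 + k * ch * s * x2 - k * c * x3"

abbreviation "N_radial' \<equiv> k * sh * c * d * x1' - k * sh * (s * d\<^sup>2 + k\<^sup>2 * s * c\<^sup>2) * \<kappa> * x1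
  + k\<^sup>2 * ch * c * s * x2' + k\<^sup>2 * ch * (c\<^sup>2 - s\<^sup>2) * d * \<kappa> * x2
  + (k\<^sup>2 * s\<^sup>2 + sh\<^sup>2) * x3' + 2 * k\<^sup>2 * s * c * d * \<kappa> * x3"
abbreviation "N_transverse' \<equiv> k * ch * s * x1' + k * ch * c * d * \<kappa> * x1
  - sh * d * x2' + sh * k\<^sup>2 * s * c * \<kappa> * x2"
abbreviation "N_axial' \<equiv> sh * d * x1' - sh * k\<^sup>2 * s * c * \<kappa> * x1
  + k * ch * s * x2' + k * ch * c * d * \<kappa> * x2 - k * c * x3' + k * s * d * \<kappa> * x3"

lemma N_axial': "N_axial' = 0"
  using squares unfolding x1' x2' x3' directions by algebra

lemma N_radial': "N_radial' * (k\<^sup>2 * s\<^sup>2 + sh\<^sup>2) - N_radial * (k\<^sup>2 * s * c * d * \<kappa>)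
    = (k\<^sup>2 + sh\<^sup>2) * (l * (k\<^sup>2 * s\<^sup>2 + sh\<^sup>2) - ch * sh * \<kappa>) * N_transverse"
  using squares unfolding x1' x2' x3' directions by algebra

lemma N_transverse': "N_transverse' * (k\<^sup>2 * s\<^sup>2 + sh\<^sup>2) - N_transverse * (k\<^sup>2 * s * c * d * \<kappa>)
    = - (l * (k\<^sup>2 * s\<^sup>2 + sh\<^sup>2) - ch * sh * \<kappa>) * N_radial"
  using squares unfolding x1' x2' x3' directions by algebra

lemma position': "(k\<^sup>2 + sh\<^sup>2) * (a * d * x1 - b * k * s * x2)
    + k\<^sup>2 * sh * s * c * x1' + k\<^sup>2 * sh * (c\<^sup>2 - s\<^sup>2) * d * \<kappa> * x1
    - k * ch * c * d * x2' + k * ch * (s * d\<^sup>2 + k\<^sup>2 * s * c\<^sup>2) * \<kappa> * x2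
    - k * s * d * x3' - k * (c * d\<^sup>2 - k\<^sup>2 * s\<^sup>2 * c) * \<kappa> * x3
    + ((k\<^sup>2 * s\<^sup>2 + sh\<^sup>2) * \<kappa> - ch * sh * l) * N_axial = 0"
  using squares unfolding x1' x2' x3' directions by algebra

lemma planar_position: "- (k * s * d * (k\<^sup>2 + sh\<^sup>2)) * N_radial + k * ch * sh * c * (k\<^sup>2 + sh\<^sup>2) * N_transverse
    = (k\<^sup>2 * s\<^sup>2 + sh\<^sup>2) * (k\<^sup>2 + sh\<^sup>2) * (k\<^sup>2 * sh * s * c * x1 - k * ch * c * d * x2 - k * s * d * x3)"
  using squares by algebra

end

context helicoid
begin

text \<open>The orthonormal frame adapted to the screw motion, written in the moving frame \<open>x1, x2, x3\<close> of the
  surface: \<open>axial\<close> is the direction of the screw axis, and \<open>radial\<close> and \<open>transverse\<close> span the plane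
  orthogonal to it. The coefficients are found by differentiating the explicit parametrization of
  \<open>- f\<close> and comparing with the frame equations. The type is a general vector space because the same formulas are used for the frame
  vectors and for their components along a fixed vector.\<close>

definition radial :: "real \<Rightarrow> 'a::real_vector \<Rightarrow> 'a \<Rightarrow> 'a \<Rightarrow> 'a" where
  "radial u x1 x2 x3 = (1 / (w * y u)) *\<^sub>R ((k * sinh r * cn u m * dn u m) *\<^sub>R x1
     + (k\<^sup>2 * cosh r * cn u m * sn u m) *\<^sub>R x2 + (y u)\<^sup>2 *\<^sub>R x3)"

definition transverse :: "real \<Rightarrow> 'a::real_vector \<Rightarrow> 'a \<Rightarrow> 'a" where
  "transverse u x1 x2 = (1 / y u) *\<^sub>R ((k * cosh r * sn u m) *\<^sub>R x1 - (sinh r * dn u m) *\<^sub>R x2)"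

definition axial :: "real \<Rightarrow> 'a::real_vector \<Rightarrow> 'a \<Rightarrow> 'a \<Rightarrow> 'a" where
  "axial u x1 x2 x3 = (1 / w) *\<^sub>R ((sinh r * dn u m) *\<^sub>R x1
     + (k * cosh r * sn u m) *\<^sub>R x2 - (k * cn u m) *\<^sub>R x3)"

text \<open>Rotation angle and height of the surface about its axis, as functions of
  \<open>u = sinh r * s + cosh r * t\<close> and \<open>l = cosh r * s + sinh r * t\<close>. Increasing \<open>l\<close> at fixed \<open>u\<close> is a screw motion.\<close>

definition phase :: "real \<Rightarrow> real \<Rightarrow> real" where
  "phase u l = psi m r u + w * l"

definition height :: "real \<Rightarrow> real \<Rightarrow> real" where
  "height u l = zeta m r u - cosh r * sinh r / w * l"

text \<open>The frame equations along the line through the origin in the direction \<open>(a, b)\<close>, after pairing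
  all vectors with a fixed one: every conservation law becomes the vanishing of the derivative of a real
  function of one variable.\<close>

context
  fixes a b \<kappa> l :: real and x1 x2 x3 g :: "real \<Rightarrow> real"
  assumes \<kappa>: "\<kappa> = sinh r * a + cosh r * b" and l: "l = cosh r * a + sinh r * b"
    and x1: "\<And>\<tau>. (x1 has_real_derivative
      - k * cn (\<tau> * \<kappa>) m * l * x2 \<tau> - a * k * sn (\<tau> * \<kappa>) m * x3 \<tau>) (at \<tau>)"
    and x2: "\<And>\<tau>. (x2 has_real_derivative
      k * cn (\<tau> * \<kappa>) m * l * x1 \<tau> - b * dn (\<tau> * \<kappa>) m * x3 \<tau>) (at \<tau>)"
    and x3: "\<And>\<tau>. (x3 has_real_derivative
      a * k * sn (\<tau> * \<kappa>) m * x1 \<tau> + b * dn (\<tau> * \<kappa>) m * x2 \<tau>) (at \<tau>)"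
    and g: "\<And>\<tau>. (g has_real_derivative
      a * dn (\<tau> * \<kappa>) m * x1 \<tau> - b * k * sn (\<tau> * \<kappa>) m * x2 \<tau>) (at \<tau>)"
begin

private abbreviation (input) "s \<tau> \<equiv> sn (\<tau> * \<kappa>) m"
private abbreviation (input) "c \<tau> \<equiv> cn (\<tau> * \<kappa>) m"
private abbreviation (input) "d \<tau> \<equiv> dn (\<tau> * \<kappa>) m"

private lemma line_derivatives:
  "((\<lambda>\<tau>. sn (\<tau> * \<kappa>) m) has_real_derivative c \<tau> * d \<tau> * \<kappa>) (at \<tau>)"
  "((\<lambda>\<tau>. cn (\<tau> * \<kappa>) m) has_real_derivative - s \<tau> * d \<tau> * \<kappa>) (at \<tau>)"
  "((\<lambda>\<tau>. dn (\<tau> * \<kappa>) m) has_real_derivative - k\<^sup>2 * s \<tau> * c \<tau> * \<kappa>) (at \<tau>)"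
  "((\<lambda>\<tau>. y (\<tau> * \<kappa>)) has_real_derivative k\<^sup>2 * s \<tau> * c \<tau> * d \<tau> * \<kappa> / y (\<tau> * \<kappa>)) (at \<tau>)"
  "((\<lambda>\<tau>. phase (\<tau> * \<kappa>) (\<tau> * l)) has_real_derivative
      w * l - w * (cosh r * sinh r * \<kappa>) / (y (\<tau> * \<kappa>))\<^sup>2) (at \<tau>)"
  "((\<lambda>\<tau>. height (\<tau> * \<kappa>) (\<tau> * l)) has_real_derivative
      ((y (\<tau> * \<kappa>))\<^sup>2 * \<kappa> - cosh r * sinh r * l) / w) (at \<tau>)"
proof -
  have lin: "((\<lambda>\<tau>. \<tau> * c) has_real_derivative c) (at \<tau>)" for c :: real
    by (auto intro!: derivative_eq_intros)
  show "((\<lambda>\<tau>. sn (\<tau> * \<kappa>) m) has_real_derivative c \<tau> * d \<tau> * \<kappa>) (at \<tau>)"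
    by (rule DERIV_chain2[OF sn_has_derivative lin])
  show "((\<lambda>\<tau>. cn (\<tau> * \<kappa>) m) has_real_derivative - s \<tau> * d \<tau> * \<kappa>) (at \<tau>)"
    by (rule DERIV_chain2[OF cn_has_derivative lin])
  show "((\<lambda>\<tau>. dn (\<tau> * \<kappa>) m) has_real_derivative - k\<^sup>2 * s \<tau> * c \<tau> * \<kappa>) (at \<tau>)"
    using DERIV_chain2[OF dn_has_derivative lin] by (simp add: k_squared)
  show "((\<lambda>\<tau>. y (\<tau> * \<kappa>)) has_real_derivative k\<^sup>2 * s \<tau> * c \<tau> * d \<tau> * \<kappa> / y (\<tau> * \<kappa>)) (at \<tau>)"
    using DERIV_chain2[OF y_has_derivative lin] by (simp add: k_squared)
  show "((\<lambda>\<tau>. phase (\<tau> * \<kappa>) (\<tau> * l)) has_real_derivative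
      w * l - w * (cosh r * sinh r * \<kappa>) / (y (\<tau> * \<kappa>))\<^sup>2) (at \<tau>)"
    unfolding phase_def
    by (auto intro!: derivative_eq_intros DERIV_chain2[OF psi_has_derivative lin])
  show "((\<lambda>\<tau>. height (\<tau> * \<kappa>) (\<tau> * l)) has_real_derivative
      ((y (\<tau> * \<kappa>))\<^sup>2 * \<kappa> - cosh r * sinh r * l) / w) (at \<tau>)"
    unfolding height_def using w_pos
    by (auto intro!: derivative_eq_intros DERIV_chain2[OF zeta_has_derivative lin] simp: diff_divide_distrib)
qed

private lemma frame_point_along_line:
  "frame_point (s \<tau>) (c \<tau>) (d \<tau>) k (sinh r) (cosh r) \<kappa> l a b (x1 \<tau>) (x2 \<tau>) (x3 \<tau>)
     (- k * c \<tau> * l * x2 \<tau> - a * k * s \<tau> * x3 \<tau>) (k * c \<tau> * l * x1 \<tau> - b * d \<tau> * x3 \<tau>)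
     (a * k * s \<tau> * x1 \<tau> + b * d \<tau> * x2 \<tau>)"
  using sn_squared_add_cn_squared[of "\<tau> * \<kappa>"]
  by unfold_locales (simp_all add: dn_squared k_squared cosh_r_squared \<kappa> l)

private lemmas line_eqs =
  frame_point.N_axial'[OF frame_point_along_line] frame_point.N_radial'[OF frame_point_along_line]
  frame_point.N_transverse'[OF frame_point_along_line] frame_point.position'[OF frame_point_along_line]
  frame_point.planar_position[OF frame_point_along_line]

private lemma w2: "k\<^sup>2 + (sinh r)\<^sup>2 = w\<^sup>2" and y2: "k\<^sup>2 * (s \<tau>)\<^sup>2 + (sinh r)\<^sup>2 = (y (\<tau> * \<kappa>))\<^sup>2"
  by (simp_all add: k_squared w_squared y_squared)

private abbreviation (input) "radial_line \<tau> \<equiv> radial (\<tau> * \<kappa>) (x1 \<tau>) (x2 \<tau>) (x3 \<tau>)"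
private abbreviation (input) "transverse_line \<tau> \<equiv> transverse (\<tau> * \<kappa>) (x1 \<tau>) (x2 \<tau>)"
private abbreviation (input) "axial_line \<tau> \<equiv> axial (\<tau> * \<kappa>) (x1 \<tau>) (x2 \<tau>) (x3 \<tau>)"
private abbreviation (input) "phase_line' \<tau> \<equiv> w * l - w * (cosh r * sinh r * \<kappa>) / (y (\<tau> * \<kappa>))\<^sup>2"

private lemma numerators_have_derivative:
  "((\<lambda>\<tau>. sinh r * d \<tau> * x1 \<tau> + k * cosh r * s \<tau> * x2 \<tau> - k * c \<tau> * x3 \<tau>) has_real_derivative 0) (at \<tau>)"
  "((\<lambda>\<tau>. k * sinh r * c \<tau> * d \<tau> * x1 \<tau> + k\<^sup>2 * cosh r * c \<tau> * s \<tau> * x2 \<tau>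
      + (k\<^sup>2 * (s \<tau>)\<^sup>2 + (sinh r)\<^sup>2) * x3 \<tau>) has_real_derivative
      k * sinh r * c \<tau> * d \<tau> * (- k * c \<tau> * l * x2 \<tau> - a * k * s \<tau> * x3 \<tau>)
      - k * sinh r * (s \<tau> * (d \<tau>)\<^sup>2 + k\<^sup>2 * s \<tau> * (c \<tau>)\<^sup>2) * \<kappa> * x1 \<tau>
      + k\<^sup>2 * cosh r * c \<tau> * s \<tau> * (k * c \<tau> * l * x1 \<tau> - b * d \<tau> * x3 \<tau>)
      + k\<^sup>2 * cosh r * ((c \<tau>)\<^sup>2 - (s \<tau>)\<^sup>2) * d \<tau> * \<kappa> * x2 \<tau>
      + (k\<^sup>2 * (s \<tau>)\<^sup>2 + (sinh r)\<^sup>2) * (a * k * s \<tau> * x1 \<tau> + b * d \<tau> * x2 \<tau>)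
      + 2 * k\<^sup>2 * s \<tau> * c \<tau> * d \<tau> * \<kappa> * x3 \<tau>) (at \<tau>)"
  "((\<lambda>\<tau>. k * cosh r * s \<tau> * x1 \<tau> - sinh r * d \<tau> * x2 \<tau>) has_real_derivative
      k * cosh r * s \<tau> * (- k * c \<tau> * l * x2 \<tau> - a * k * s \<tau> * x3 \<tau>) + k * cosh r * c \<tau> * d \<tau> * \<kappa> * x1 \<tau>
      - sinh r * d \<tau> * (k * c \<tau> * l * x1 \<tau> - b * d \<tau> * x3 \<tau>) + sinh r * k\<^sup>2 * s \<tau> * c \<tau> * \<kappa> * x2 \<tau>) (at \<tau>)"
  subgoal
    unfolding line_eqs(1)[of \<tau>, symmetric]
    by (rule derivative_eq_intros line_derivatives x1 x2 x3 refl)+ (simp add: algebra_simps power2_eq_square)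
  subgoal
    by (rule derivative_eq_intros line_derivatives x1 x2 x3 refl)+ (simp add: algebra_simps power2_eq_square)
  subgoal
    by (rule derivative_eq_intros line_derivatives x1 x2 x3 refl)+ (simp add: algebra_simps power2_eq_square)
  done

private lemma radial_has_derivative:
  "((\<lambda>\<tau>. radial_line \<tau>) has_real_derivative phase_line' \<tau> * transverse_line \<tau>) (at \<tau>)"
proof -
  have nz: "w \<noteq> 0" "y (\<tau> * \<kappa>) \<noteq> 0"
    using w_pos y_pos[of "\<tau> * \<kappa>"] by auto
  show ?thesis
    unfolding radial_def transverse_def real_scaleR_def times_divide_eq_left mult_1
    by (rule DERIV_cong[OF DERIV_divide[OF numerators_have_derivative(2)[unfolded y2] DERIV_cmult[OF line_derivatives(4)]]
          quotient_rule_rescaled[OF nz line_eqs(2)[unfolded w2 y2]]])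
      (use nz in simp)
qed

private lemma transverse_has_derivative:
  "((\<lambda>\<tau>. transverse_line \<tau>) has_real_derivative - (phase_line' \<tau> * radial_line \<tau>)) (at \<tau>)"
proof -
  have nz: "w \<noteq> 0" "y (\<tau> * \<kappa>) \<noteq> 0"
    using w_pos y_pos[of "\<tau> * \<kappa>"] by auto
  have *: "(N' * y - N * (q / y)) / (y * y) = - ((w * l - w * j / y\<^sup>2) * (T / (w * y)))"
    if "y \<noteq> 0" "N' * y\<^sup>2 - N * q = - (l * y\<^sup>2 - j) * T" for N' N q j T y :: real
  proof -
    have "(N' * y - N * (q / y)) / (y * y) = (N' * y\<^sup>2 - N * q) / y ^ 3"
      using that(1) by (simp add: field_simps power2_eq_square power3_eq_cube)
    also have "\<dots> = - ((w * l - w * j / y\<^sup>2) * (T / (w * y)))"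
      using that(1) nz(1) unfolding that(2) by (simp add: field_simps power2_eq_square power3_eq_cube)
    finally show ?thesis .
  qed
  show ?thesis
    unfolding radial_def transverse_def real_scaleR_def times_divide_eq_left mult_1
    by (rule DERIV_cong[OF DERIV_divide[OF numerators_have_derivative(3)[unfolded y2] line_derivatives(4) nz(2)]
          *[OF nz(2) line_eqs(3)[unfolded w2 y2]]])
qed

lemma axial_along_line: "axial_line \<tau> = axial_line 0"
proof -
  have "sinh r * d \<tau> * x1 \<tau> + k * cosh r * s \<tau> * x2 \<tau> - k * c \<tau> * x3 \<tau>
      = sinh r * d 0 * x1 0 + k * cosh r * s 0 * x2 0 - k * c 0 * x3 0"
    using numerators_have_derivative(1) by (intro DERIV_isconst_all) blast
  then show ?thesis by (simp add: axial_def)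
qed

private abbreviation (input) "cos_line \<tau> \<equiv> cos (phase (\<tau> * \<kappa>) (\<tau> * l))"
private abbreviation (input) "sin_line \<tau> \<equiv> sin (phase (\<tau> * \<kappa>) (\<tau> * l))"

text \<open>The pair \<open>radial, transverse\<close> turns with angular velocity equal to the derivative of the phase, so
  rotating it back by the phase produces constant vectors.\<close>

lemma rotated_frame_along_line:
  "cos_line \<tau> * radial_line \<tau> - sin_line \<tau> * transverse_line \<tau>
    = cos_line 0 * radial_line 0 - sin_line 0 * transverse_line 0"
  "sin_line \<tau> * radial_line \<tau> + cos_line \<tau> * transverse_line \<tau>
    = sin_line 0 * radial_line 0 + cos_line 0 * transverse_line 0"
proof -
  note intros = derivative_eq_intros line_derivatives(5) radial_has_derivative transverse_has_derivative refl
  have "((\<lambda>\<tau>. cos_line \<tau> * radial_line \<tau> - sin_line \<tau> * transverse_line \<tau>) has_real_derivative 0) (at \<tau>)" for \<tau>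
    by (rule intros)+ (simp add: algebra_simps)
  then show "cos_line \<tau> * radial_line \<tau> - sin_line \<tau> * transverse_line \<tau>
    = cos_line 0 * radial_line 0 - sin_line 0 * transverse_line 0"
    by (intro DERIV_isconst_all) blast
  have "((\<lambda>\<tau>. sin_line \<tau> * radial_line \<tau> + cos_line \<tau> * transverse_line \<tau>) has_real_derivative 0) (at \<tau>)" for \<tau>
    by (rule intros)+ (simp add: algebra_simps)
  then show "sin_line \<tau> * radial_line \<tau> + cos_line \<tau> * transverse_line \<tau>
    = sin_line 0 * radial_line 0 + cos_line 0 * transverse_line 0"
    by (intro DERIV_isconst_all) blast
qed

text \<open>In the moving frame the planar part of the position has polynomial coefficients, which makes it
  easy to differentiate.\<close>

private lemma planar_position_line:
  "radial_coord (\<tau> * \<kappa>) * radial_line \<tau> + transverse_coord (\<tau> * \<kappa>) * transverse_line \<tau>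
    = (k\<^sup>2 * sinh r * s \<tau> * c \<tau> * x1 \<tau> - k * cosh r * c \<tau> * d \<tau> * x2 \<tau> - k * s \<tau> * d \<tau> * x3 \<tau>) / w\<^sup>2"
proof -
  have nz: "w \<noteq> 0" "y (\<tau> * \<kappa>) \<noteq> 0"
    using w_pos y_pos[of "\<tau> * \<kappa>"] by auto
  have *: "- k * s * d / (w * y) * (1 / (w * y) * N) + k * ch * sh * c / (w\<^sup>2 * y) * (1 / y * T) = V / w\<^sup>2"
    if "y \<noteq> 0" "- (k * s * d * w\<^sup>2) * N + k * ch * sh * c * w\<^sup>2 * T = y\<^sup>2 * w\<^sup>2 * V" for s c d sh ch y N T V :: real
  proof -
    have "- k * s * d / (w * y) * (1 / (w * y) * N) + k * ch * sh * c / (w\<^sup>2 * y) * (1 / y * T)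
        = (- (k * s * d * w\<^sup>2) * N + k * ch * sh * c * w\<^sup>2 * T) / (w\<^sup>2 * w\<^sup>2 * y\<^sup>2)"
      using that(1) nz(1) by (simp add: field_simps power2_eq_square)
    also have "\<dots> = V / w\<^sup>2"
      using that(1) nz(1) unfolding that(2) by (simp add: field_simps power2_eq_square)
    finally show ?thesis .
  qed
  show ?thesis
    unfolding radial_def transverse_def radial_coord_def transverse_coord_def real_scaleR_def
    by (rule *[OF nz(2) line_eqs(5)[unfolded w2 y2]])
qed

text \<open>The surface is recovered from the adapted frame: the derivative of the position \<open>g\<close> cancels
  that of the planar part plus the height times the axis. Since the axis is constant,
  only the height contributes to the derivative of the last term.\<close>

lemma position_along_line:
  "g \<tau> + (radial_coord (\<tau> * \<kappa>) * radial_line \<tau> + transverse_coord (\<tau> * \<kappa>) * transverse_line \<tau>) + height (\<tau> * \<kappa>) (\<tau> * l) * axial_line \<tau>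
    = g 0 + (radial_coord (0 * \<kappa>) * radial_line 0 + transverse_coord (0 * \<kappa>) * transverse_line 0) + height (0 * \<kappa>) (0 * l) * axial_line 0"
proof -
  let ?A = "axial_line 0"
  define V where "V \<tau> = g \<tau> + (k\<^sup>2 * sinh r * s \<tau> * c \<tau> * x1 \<tau> - k * cosh r * c \<tau> * d \<tau> * x2 \<tau> - k * s \<tau> * d \<tau> * x3 \<tau>) / w\<^sup>2
    + height (\<tau> * \<kappa>) (\<tau> * l) * ?A" for \<tau>
  have "(V has_real_derivative 0) (at \<tau>)" for \<tau>
  proof -
    let ?x1' = "- k * c \<tau> * l * x2 \<tau> - a * k * s \<tau> * x3 \<tau>" and ?x2' = "k * c \<tau> * l * x1 \<tau> - b * d \<tau> * x3 \<tau>"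
      and ?x3' = "a * k * s \<tau> * x1 \<tau> + b * d \<tau> * x2 \<tau>"
    let ?N = "k\<^sup>2 * sinh r * s \<tau> * c \<tau> * ?x1' + k\<^sup>2 * sinh r * ((c \<tau>)\<^sup>2 - (s \<tau>)\<^sup>2) * d \<tau> * \<kappa> * x1 \<tau>
      - k * cosh r * c \<tau> * d \<tau> * ?x2' + k * cosh r * (s \<tau> * (d \<tau>)\<^sup>2 + k\<^sup>2 * s \<tau> * (c \<tau>)\<^sup>2) * \<kappa> * x2 \<tau>
      - k * s \<tau> * d \<tau> * ?x3' - k * (c \<tau> * (d \<tau>)\<^sup>2 - k\<^sup>2 * (s \<tau>)\<^sup>2 * c \<tau>) * \<kappa> * x3 \<tau>"
    have "((\<lambda>\<tau>. k\<^sup>2 * sinh r * s \<tau> * c \<tau> * x1 \<tau> - k * cosh r * c \<tau> * d \<tau> * x2 \<tau> - k * s \<tau> * d \<tau> * x3 \<tau>)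
        has_real_derivative ?N) (at \<tau>)"
      by (rule derivative_eq_intros line_derivatives x1 x2 x3 refl)+ (simp add: algebra_simps power2_eq_square)
    then have "(V has_real_derivative (a * d \<tau> * x1 \<tau> - b * k * s \<tau> * x2 \<tau>) + ?N / w\<^sup>2
        + ((y (\<tau> * \<kappa>))\<^sup>2 * \<kappa> - cosh r * sinh r * l) / w * ?A) (at \<tau>)"
      unfolding V_def by (intro DERIV_add DERIV_cdivide DERIV_cmult_right g line_derivatives(6))
    moreover have "?A = (sinh r * d \<tau> * x1 \<tau> + k * cosh r * s \<tau> * x2 \<tau> - k * c \<tau> * x3 \<tau>) / w"
      by (subst axial_along_line[of \<tau>, symmetric]) (simp add: axial_def)
    moreover have "(a * d \<tau> * x1 \<tau> - b * k * s \<tau> * x2 \<tau>) + ?N / w\<^sup>2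
        + ((y (\<tau> * \<kappa>))\<^sup>2 * \<kappa> - cosh r * sinh r * l) / w
          * ((sinh r * d \<tau> * x1 \<tau> + k * cosh r * s \<tau> * x2 \<tau> - k * c \<tau> * x3 \<tau>) / w) = 0"
    proof -
      have *: "G + N / w\<^sup>2 + H / w * (A / w) = (w\<^sup>2 * G + N + H * A) / w\<^sup>2" for G N H A
        using w_pos by (simp add: field_simps power2_eq_square)
      show ?thesis
        unfolding * using line_eqs(4)[of \<tau>, unfolded w2 y2] by (simp only: add_diff_eq add.assoc[symmetric] div_0)
    qed
    ultimately show ?thesis by simp
  qed
  then have "V \<tau> = V 0"
    by (intro DERIV_isconst_all) blast
  then show ?thesis
    unfolding V_def planar_position_line axial_along_line[of \<tau>] .
qed

end

end

section \<open>The congruence with the reflected surface\<close>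

lemma rotation_matrix_mult:
  fixes A B :: "real^'n^'n"
  assumes "rotation_matrix A" "rotation_matrix B"
  shows "rotation_matrix (A ** B)"
  using assms by (auto simp: rotation_matrix_def det_mul intro: orthogonal_matrix_mul)

lemma rotation_matrix_transpose:
  assumes "rotation_matrix A"
  shows "rotation_matrix (transpose A)"
  using assms by (simp add: rotation_matrix_def det_transpose)

lemma transpose_rows_mult_vector:
  fixes a b c :: "real^3"
  shows "transpose (vector [a, b, c] :: real^3^3) *v vector [x, y, z] = x *\<^sub>R a + y *\<^sub>R b + z *\<^sub>R c"
  by (simp add: vec_eq_iff matrix_vector_mult_def transpose_def sum_3 vector_3 mult.commute)

text \<open>The coefficients form an orthogonal matrix of determinant 1. For \<open>p = k / w\<close>, \<open>q = sinh r / w\<close> this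
  is the adapted frame at the origin, rotated back by its phase; this single point decides the orientation of the
  congruence.\<close>

lemma rotated_frame_positive_orthonormal:
  assumes e: "positive_orthonormal e1 e2 e3"
    and pq: "p\<^sup>2 + q\<^sup>2 = (1 :: real)"
  shows "positive_orthonormal
    (cos \<theta> *\<^sub>R (p *\<^sub>R e1 + q *\<^sub>R e3) + sin \<theta> *\<^sub>R e2)
    (sin \<theta> *\<^sub>R (p *\<^sub>R e1 + q *\<^sub>R e3) - cos \<theta> *\<^sub>R e2)
    (q *\<^sub>R e1 - p *\<^sub>R e3)"
proof -
  let ?C = "vector [vector [cos \<theta> * p, sin \<theta>, cos \<theta> * q],
    vector [sin \<theta> * p, - cos \<theta>, sin \<theta> * q], vector [q, 0, - p]] :: real^3^3"
  have sc: "(sin \<theta>)\<^sup>2 + (cos \<theta>)\<^sup>2 = 1" by simp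
  have "rotation_matrix ?C"
  proof -
    have "cos \<theta> * p * (cos \<theta> * p) + sin \<theta> * sin \<theta> + cos \<theta> * q * (cos \<theta> * q) = 1"
      "sin \<theta> * p * (sin \<theta> * p) + cos \<theta> * cos \<theta> + sin \<theta> * q * (sin \<theta> * q) = 1"
      "q * q + p * p = 1"
      "cos \<theta> * p * (sin \<theta> * p) - sin \<theta> * cos \<theta> + cos \<theta> * q * (sin \<theta> * q) = 0"
      "cos \<theta> * p * - cos \<theta> * - p + sin \<theta> * (sin \<theta> * q) * q - (cos \<theta> * q * - cos \<theta> * q) - sin \<theta> * (sin \<theta> * p) * - p = 1"
      using pq sc by algebra+
    then show ?thesis
      unfolding positive_orthonormal_iff_rotation_matrix[symmetric] positive_orthonormal_def
      by (simp add: norm_eq_1 inner_vec_def sum_3 vector_3 det_3 algebra_simps)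
  qed
  then have "rotation_matrix (?C ** vector [e1, e2, e3])"
    using e by (intro rotation_matrix_mult) (auto simp: positive_orthonormal_iff_rotation_matrix)
  moreover have "?C ** vector [e1, e2, e3] = vector [
    cos \<theta> *\<^sub>R (p *\<^sub>R e1 + q *\<^sub>R e3) + sin \<theta> *\<^sub>R e2,
    sin \<theta> *\<^sub>R (p *\<^sub>R e1 + q *\<^sub>R e3) - cos \<theta> *\<^sub>R e2,
    q *\<^sub>R e1 - p *\<^sub>R e3]"
    by (simp add: vec_eq_iff forall_3 matrix_matrix_mult_def sum_3 vector_3 algebra_simps)
  ultimately show ?thesis
    by (simp add: positive_orthonormal_iff_rotation_matrix)
qed

context helicoid
begin

definition u_coord :: "real \<times> real \<Rightarrow> real" where
  "u_coord p = sinh r * fst p + cosh r * snd p"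

definition l_coord :: "real \<times> real \<Rightarrow> real" where
  "l_coord p = cosh r * fst p + sinh r * snd p"

lemma f_tilde_eq:
  "f_tilde m r (u, w * l / (2 * pi)) = vector
     [cos (phase u l) * radial_coord u - sin (phase u l) * transverse_coord u,
      sin (phase u l) * radial_coord u + cos (phase u l) * transverse_coord u,
      height u l]"
proof -
  have "2 * pi * (w * l / (2 * pi)) = w * l" by simp
  moreover have "rho m r * (w * l / (2 * pi)) = - (cosh r * sinh r / w * l)"
  proof -
    have "rho m r = - 2 * pi * (cosh r * sinh r / w\<^sup>2)"
      by (simp add: rho_def w_squared)
    then show ?thesis
      using w_pos by (simp add: field_simps power2_eq_square)
  qed
  ultimately show ?thesis
    by (simp add: f_tilde_def x_tilde_def y_tilde_def z_tilde_def xi_q1_eq xi_q2_eq phase_def height_def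
        cos_add sin_add algebra_simps)
qed

text \<open>The linear map \<open>(s, t) \<mapsto> (u, l)\<close> has determinant \<open>sinh\<^sup>2 r - cosh\<^sup>2 r = -1\<close>, so it is only a change of
  parameters.\<close>

lemma range_f_tilde:
  "range (f_tilde m r) = range (\<lambda>p. f_tilde m r (u_coord p, w * l_coord p / (2 * pi)))"
proof -
  let ?\<sigma> = "\<lambda>p. (u_coord p, w * l_coord p / (2 * pi))"
  have "\<exists>p. z = ?\<sigma> p" for z
  proof -
    obtain u v where z: "z = (u, v)" by force
    define l where "l = 2 * pi * v / w"
    let ?p = "(cosh r * l - sinh r * u, cosh r * u - sinh r * l)"
    have "u_coord ?p = u" "l_coord ?p = l"
      using cosh_r_squared unfolding u_coord_def l_coord_def fst_conv snd_conv by algebra+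
    then show ?thesis
      using w_pos by (intro exI[of _ ?p]) (simp add: z l_def)
  qed
  then have "surj ?\<sigma>"
    unfolding surj_def by blast
  moreover have "range (\<lambda>p. f_tilde m r (?\<sigma> p)) = f_tilde m r ` range ?\<sigma>"
    by (simp only: image_image)
  ultimately show ?thesis by simp
qed

lemma helicoid_angle_eq:
  "helicoid_angle (inverse m) r p / 2 = - am (sqrt m * u_coord p) (inverse m)"
proof -
  have "a / sqrt (inverse m) = sqrt m * a" for a
    unfolding real_sqrt_inverse divide_inverse inverse_inverse_eq by (rule mult.commute)
  then show ?thesis
    by (cases p) (simp add: helicoid_angle_def u_coord_def distrib_left mult.assoc)
qed

text \<open>After Jacobi's transformation the half angle satisfies \<open>sin \<alpha> = - k * sn u\<close> and \<open>cos \<alpha> = dn u\<close>. The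
  latter never vanishes, and the former vanishes only on a discrete family of parallel lines.\<close>

lemma helicoid_frame_equations:
  assumes f: "pseudospherical_map (helicoid_angle (inverse m) r) f"
  obtains e1 e2 e3 where
    "\<And>p. positive_orthonormal (e1 p) (e2 p) (e3 p)"
    "\<And>p. (f has_derivative (\<lambda>h. (fst h * dn (u_coord p) m) *\<^sub>R e1 p
        - (snd h * k * sn (u_coord p) m) *\<^sub>R e2 p)) (at p)"
    "\<And>p. (e1 has_derivative (\<lambda>h. - (k * cn (u_coord p) m * l_coord h) *\<^sub>R e2 p
        - (fst h * k * sn (u_coord p) m) *\<^sub>R e3 p)) (at p)"
    "\<And>p. (e2 has_derivative (\<lambda>h. (k * cn (u_coord p) m * l_coord h) *\<^sub>R e1 p
        - (snd h * dn (u_coord p) m) *\<^sub>R e3 p)) (at p)"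
    "\<And>p. (e3 has_derivative (\<lambda>h. (fst h * k * sn (u_coord p) m) *\<^sub>R e1 p
        + (snd h * dn (u_coord p) m) *\<^sub>R e2 p)) (at p)"
proof -
  define \<alpha> where "\<alpha> p = - am (sqrt m * u_coord p) (inverse m)" for p
  have arg: "sqrt m * u / sqrt m = u" for u
    using m_pos by simp
  have sin_\<alpha>: "sin (\<alpha> p) = - (k * sn (u_coord p) m)" and cos_\<alpha>: "cos (\<alpha> p) = dn (u_coord p) m" for p
    by (simp_all add: \<alpha>_def am_reciprocal_parameter(2,3) arg k_def)
  have chain: "((\<lambda>x. - am (sqrt m * v x) (inverse m)) has_real_derivative - (k * v' * cn (v x) m)) (at x)"
    if "(v has_real_derivative v') (at x)" for v v' x
    using DERIV_minus[OF DERIV_chain2[OF am_reciprocal_parameter(1) DERIV_cmult[OF that, of "sqrt m"]]]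
    by (simp add: arg k_def mult_ac)
  have cont_u: "isCont u_coord p" for p
    unfolding u_coord_def[abs_def] by (intro continuous_intros)
  have cont_am: "isCont (\<lambda>x. am x (inverse m)) x" for x
    by (rule DERIV_isCont[OF am_reciprocal_parameter(1)])
  have cont_cn: "isCont (\<lambda>x. cn x m) x" for x
    by (rule DERIV_isCont[OF cn_has_derivative])
  show thesis
  proof (rule pseudospherical_frame_equations[OF f, of \<alpha> "\<lambda>p. - (k * sinh r * cn (u_coord p) m)"
        "\<lambda>p. - (k * cosh r * cn (u_coord p) m)"])
    show "helicoid_angle (inverse m) r p / 2 = \<alpha> p" for p
      unfolding \<alpha>_def by (rule helicoid_angle_eq)
    show "((\<lambda>s. \<alpha> (s, t)) has_real_derivative - (k * sinh r * cn (u_coord (s, t)) m)) (at s)" for s t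
      unfolding \<alpha>_def by (rule chain) (auto simp: u_coord_def intro!: derivative_eq_intros)
    show "((\<lambda>t. \<alpha> (s, t)) has_real_derivative - (k * cosh r * cn (u_coord (s, t)) m)) (at t)" for s t
      unfolding \<alpha>_def by (rule chain) (auto simp: u_coord_def intro!: derivative_eq_intros)
    show "isCont \<alpha> p" for p
      unfolding \<alpha>_def[abs_def] by (intro continuous_intros isCont_o2[OF _ cont_am] cont_u)
    show "isCont (\<lambda>p. - (k * sinh r * cn (u_coord p) m)) p" for p
      by (intro continuous_intros isCont_o2[OF cont_u cont_cn])
    show "isCont (\<lambda>p. - (k * cosh r * cn (u_coord p) m)) p" for p
      by (intro continuous_intros isCont_o2[OF cont_u cont_cn])
    show "cos (\<alpha> p) \<noteq> 0" for p
      using dn_pos[of "u_coord p"] by (simp add: cos_\<alpha>)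
    show "\<exists>\<^sub>F q in at p. sin (\<alpha> q) \<noteq> 0" for p
    proof -
      \<comment> \<open>approach \<open>p\<close> along the second coordinate axis, with the value of \<open>u\<close> as parameter\<close>
      let ?q = "\<lambda>x. (fst p, snd p + (x - u_coord p) / cosh r)"
      have lim: "filterlim ?q (at p) (at (u_coord p))"
        unfolding filterlim_at
      proof
        show "(?q \<longlongrightarrow> p) (at (u_coord p))"
          by (rule tendsto_eq_intros refl | simp)+
        show "\<forall>\<^sub>F x in at (u_coord p). ?q x \<in> UNIV \<and> ?q x \<noteq> p"
          using eventually_neq_at_within[of "u_coord p"] by eventually_elim (auto simp: prod_eq_iff)
      qed
      have "u_coord (?q x) = x" for x
        by (simp add: u_coord_def field_simps)
      then have "\<exists>\<^sub>F x in at (u_coord p). sin (\<alpha> (?q x)) \<noteq> 0"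
        using eventually_sn_nonzero[of "u_coord p"] m_pos
        by (intro eventually_frequently) (auto simp: sin_\<alpha> k_def)
      then show ?thesis
        using lim eventually_compose_filterlim[of "\<lambda>q. \<not> sin (\<alpha> q) \<noteq> 0" "at p" ?q "at (u_coord p)"]
        unfolding frequently_def by blast
    qed
  next
    fix e1 e2 e3
    assume e: "\<And>p. positive_orthonormal (e1 p) (e2 p) (e3 p)"
      and der: "\<And>p. (f has_derivative (\<lambda>h. (fst h * cos (\<alpha> p)) *\<^sub>R e1 p + (snd h * sin (\<alpha> p)) *\<^sub>R e2 p)) (at p)"
      "\<And>p. (e1 has_derivative (\<lambda>h. (fst h * - (k * cosh r * cn (u_coord p) m) + snd h * - (k * sinh r * cn (u_coord p) m)) *\<^sub>R e2 p
          + (fst h * sin (\<alpha> p)) *\<^sub>R e3 p)) (at p)"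
      "\<And>p. (e2 has_derivative (\<lambda>h. - (fst h * - (k * cosh r * cn (u_coord p) m) + snd h * - (k * sinh r * cn (u_coord p) m)) *\<^sub>R e1 p
          - (snd h * cos (\<alpha> p)) *\<^sub>R e3 p)) (at p)"
      "\<And>p. (e3 has_derivative (\<lambda>h. - (fst h * sin (\<alpha> p)) *\<^sub>R e1 p + (snd h * cos (\<alpha> p)) *\<^sub>R e2 p)) (at p)"
    have l: "fst h * - (k * cosh r * cn (u_coord p) m) + snd h * - (k * sinh r * cn (u_coord p) m)
        = - (k * cn (u_coord p) m * l_coord h)" for h p
      by (simp add: l_coord_def algebra_simps)
    note der = der[unfolded l sin_\<alpha> cos_\<alpha>]
    show thesis
    proof (rule that[of e1 e2 e3])
      fix p
      show "positive_orthonormal (e1 p) (e2 p) (e3 p)" by (rule e)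
      show "(f has_derivative (\<lambda>h. (fst h * dn (u_coord p) m) *\<^sub>R e1 p
          - (snd h * k * sn (u_coord p) m) *\<^sub>R e2 p)) (at p)"
        using der(1)[of p] by (simp add: mult.assoc)
      show "(e1 has_derivative (\<lambda>h. - (k * cn (u_coord p) m * l_coord h) *\<^sub>R e2 p
          - (fst h * k * sn (u_coord p) m) *\<^sub>R e3 p)) (at p)"
        using der(2)[of p] by (simp add: mult.assoc)
      show "(e2 has_derivative (\<lambda>h. (k * cn (u_coord p) m * l_coord h) *\<^sub>R e1 p
          - (snd h * dn (u_coord p) m) *\<^sub>R e3 p)) (at p)"
        using der(3)[of p] by (simp add: mult.assoc)
      show "(e3 has_derivative (\<lambda>h. (fst h * k * sn (u_coord p) m) *\<^sub>R e1 p
          + (snd h * dn (u_coord p) m) *\<^sub>R e2 p)) (at p)"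
        using der(4)[of p] by (simp add: mult.assoc)
    qed
  qed
qed

text \<open>The columns of \<open>A\<close> are the three constant vectors \<open>X\<close>, \<open>Y\<close>, \<open>Z\<close> of the adapted frame. Expressed in them,
  the constancy of \<open>V\<close> says that \<open>- f\<close> is the explicit parametrization up to a translation.\<close>

lemma reflected_f_tilde_congruent:
  assumes f: "pseudospherical_map (helicoid_angle (inverse m) r) f"
  shows "\<exists>A b. rotation_matrix A \<and>
    (\<forall>p. A *v f_tilde m r (u_coord p, w * l_coord p / (2 * pi)) + b = - f p)"
proof (rule helicoid_frame_equations[OF f])
  fix e1 e2 e3
  assume e: "\<And>p. positive_orthonormal (e1 p) (e2 p) (e3 p)"
    and der: "\<And>p. (f has_derivative (\<lambda>h. (fst h * dn (u_coord p) m) *\<^sub>R e1 p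
        - (snd h * k * sn (u_coord p) m) *\<^sub>R e2 p)) (at p)"
    "\<And>p. (e1 has_derivative (\<lambda>h. - (k * cn (u_coord p) m * l_coord h) *\<^sub>R e2 p
        - (fst h * k * sn (u_coord p) m) *\<^sub>R e3 p)) (at p)"
    "\<And>p. (e2 has_derivative (\<lambda>h. (k * cn (u_coord p) m * l_coord h) *\<^sub>R e1 p
        - (snd h * dn (u_coord p) m) *\<^sub>R e3 p)) (at p)"
    "\<And>p. (e3 has_derivative (\<lambda>h. (fst h * k * sn (u_coord p) m) *\<^sub>R e1 p
        + (snd h * dn (u_coord p) m) *\<^sub>R e2 p)) (at p)"
  define P where "P p = radial (u_coord p) (e1 p) (e2 p) (e3 p)" for p
  define T where "T p = transverse (u_coord p) (e1 p) (e2 p)" for p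
  define Z where "Z p = axial (u_coord p) (e1 p) (e2 p) (e3 p)" for p
  define \<theta> where "\<theta> p = phase (u_coord p) (l_coord p)" for p
  define X where "X p = cos (\<theta> p) *\<^sub>R P p - sin (\<theta> p) *\<^sub>R T p" for p
  define Y where "Y p = sin (\<theta> p) *\<^sub>R P p + cos (\<theta> p) *\<^sub>R T p" for p
  define V where "V p = f p + (radial_coord (u_coord p) *\<^sub>R P p + transverse_coord (u_coord p) *\<^sub>R T p)
    + height (u_coord p) (l_coord p) *\<^sub>R Z p" for p
  note defs = P_def T_def Z_def X_def Y_def V_def \<theta>_def

  have const: "Z p \<bullet> v = Z 0 \<bullet> v \<and> X p \<bullet> v = X 0 \<bullet> v \<and> Y p \<bullet> v = Y 0 \<bullet> v \<and> V p \<bullet> v = V 0 \<bullet> v" for p v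
  proof -
    let ?a = "fst p" and ?b = "snd p"
    have \<kappa>: "u_coord p = sinh r * ?a + cosh r * ?b" and l: "l_coord p = cosh r * ?a + sinh r * ?b"
      by (simp_all add: u_coord_def l_coord_def)
    have scale: "u_coord (\<tau> *\<^sub>R p) = \<tau> * u_coord p" "l_coord (\<tau> *\<^sub>R p) = \<tau> * l_coord p" for \<tau>
      by (simp_all add: u_coord_def l_coord_def algebra_simps)
    have line: "((\<lambda>\<tau>. g (\<tau> *\<^sub>R p) \<bullet> v) has_real_derivative g' p \<bullet> v) (at \<tau>)"
      if "(g has_derivative g') (at (\<tau> *\<^sub>R p))" for g :: "real \<times> real \<Rightarrow> real^3" and g' \<tau>
      using has_derivative_along_line[of g g' 0 \<tau> p v] that by simp
    have ode: "((\<lambda>\<tau>. e1 (\<tau> *\<^sub>R p) \<bullet> v) has_real_derivative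
        - k * cn (\<tau> * u_coord p) m * l_coord p * (e2 (\<tau> *\<^sub>R p) \<bullet> v) - ?a * k * sn (\<tau> * u_coord p) m * (e3 (\<tau> *\<^sub>R p) \<bullet> v)) (at \<tau>)"
      "((\<lambda>\<tau>. e2 (\<tau> *\<^sub>R p) \<bullet> v) has_real_derivative
        k * cn (\<tau> * u_coord p) m * l_coord p * (e1 (\<tau> *\<^sub>R p) \<bullet> v) - ?b * dn (\<tau> * u_coord p) m * (e3 (\<tau> *\<^sub>R p) \<bullet> v)) (at \<tau>)"
      "((\<lambda>\<tau>. e3 (\<tau> *\<^sub>R p) \<bullet> v) has_real_derivative
        ?a * k * sn (\<tau> * u_coord p) m * (e1 (\<tau> *\<^sub>R p) \<bullet> v) + ?b * dn (\<tau> * u_coord p) m * (e2 (\<tau> *\<^sub>R p) \<bullet> v)) (at \<tau>)"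
      "((\<lambda>\<tau>. f (\<tau> *\<^sub>R p) \<bullet> v) has_real_derivative
        ?a * dn (\<tau> * u_coord p) m * (e1 (\<tau> *\<^sub>R p) \<bullet> v) - ?b * k * sn (\<tau> * u_coord p) m * (e2 (\<tau> *\<^sub>R p) \<bullet> v)) (at \<tau>)" for \<tau>
      using line[OF der(2)] line[OF der(3)] line[OF der(4)] line[OF der(1)]
      by (simp_all add: scale inner_diff_left inner_add_left)
    note conserved = axial_along_line[OF \<kappa> l ode, of 1] rotated_frame_along_line[OF \<kappa> l ode, of 1]
      position_along_line[OF \<kappa> l ode, of 1]
    have inner: "radial u x1 x2 x3 \<bullet> v = radial u (x1 \<bullet> v) (x2 \<bullet> v) (x3 \<bullet> v)"
      "transverse u x1 x2 \<bullet> v = transverse u (x1 \<bullet> v) (x2 \<bullet> v)"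
      "axial u x1 x2 x3 \<bullet> v = axial u (x1 \<bullet> v) (x2 \<bullet> v) (x3 \<bullet> v)" for u and x1 x2 x3 :: "real^3"
      by (simp_all add: radial_def transverse_def axial_def inner_diff_left inner_add_left)
    have zero: "u_coord 0 = 0" "l_coord 0 = 0"
      by (simp_all add: u_coord_def l_coord_def)
    show ?thesis
      using conserved unfolding defs
      by (simp add: inner_diff_left inner_add_left inner zero)
  qed
  have const: "Z p = Z 0" "X p = X 0" "Y p = Y 0" "V p = V 0" for p
    using const vector_eq_rdot by blast+

  define A where "A = transpose (vector [X 0, Y 0, Z 0] :: real^3^3)"
  have "rotation_matrix A"
  proof -
    have zero: "u_coord 0 = 0" "y 0 = sinh r"
      using sinh_r_pos by (simp_all add: u_coord_def y_def sn_0)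
    have "P 0 = (k / w) *\<^sub>R e1 0 + (sinh r / w) *\<^sub>R e3 0" "T 0 = - e2 0"
      "Z 0 = (sinh r / w) *\<^sub>R e1 0 - (k / w) *\<^sub>R e3 0"
      using sinh_r_pos w_pos
      by (simp_all add: P_def T_def Z_def zero radial_def transverse_def axial_def sn_0 cn_0 dn_0
          scaleR_add_right scaleR_diff_right power2_eq_square)
    moreover have "(k / w)\<^sup>2 + (sinh r / w)\<^sup>2 = 1"
    proof -
      have "(k / w)\<^sup>2 + (sinh r / w)\<^sup>2 = (k\<^sup>2 + (sinh r)\<^sup>2) / w\<^sup>2"
        by (simp add: power_divide add_divide_distrib)
      also have "k\<^sup>2 + (sinh r)\<^sup>2 = w\<^sup>2"
        by (simp add: k_squared w_squared)
      finally show ?thesis using w_pos by simp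
    qed
    ultimately have "positive_orthonormal (X 0) (Y 0) (Z 0)"
      using rotated_frame_positive_orthonormal[OF e[of 0], of "k / w" "sinh r / w" "\<theta> 0"]
      by (simp add: X_def Y_def)
    then show ?thesis
      unfolding A_def by (intro rotation_matrix_transpose) (simp add: positive_orthonormal_iff_rotation_matrix)
  qed
  moreover have "A *v f_tilde m r (u_coord p, w * l_coord p / (2 * pi)) + - V 0 = - f p" for p
  proof -
    have "A *v f_tilde m r (u_coord p, w * l_coord p / (2 * pi)) =
        (cos (\<theta> p) * radial_coord (u_coord p) - sin (\<theta> p) * transverse_coord (u_coord p)) *\<^sub>R X p
        + (sin (\<theta> p) * radial_coord (u_coord p) + cos (\<theta> p) * transverse_coord (u_coord p)) *\<^sub>R Y p
        + height (u_coord p) (l_coord p) *\<^sub>R Z p"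
      unfolding A_def f_tilde_eq transpose_rows_mult_vector const[of p] \<theta>_def ..
    also have "\<dots> = ((cos (\<theta> p))\<^sup>2 + (sin (\<theta> p))\<^sup>2) *\<^sub>R (radial_coord (u_coord p) *\<^sub>R P p + transverse_coord (u_coord p) *\<^sub>R T p)
        + height (u_coord p) (l_coord p) *\<^sub>R Z p"
    proof -
      have "(C * x - S * z) *\<^sub>R (C *\<^sub>R a - S *\<^sub>R b) + (S * x + C * z) *\<^sub>R (S *\<^sub>R a + C *\<^sub>R b)
          = (C\<^sup>2 + S\<^sup>2) *\<^sub>R (x *\<^sub>R a + z *\<^sub>R b)" for C S x z :: real and a b :: "real^3"
        by (simp add: algebra_simps power2_eq_square)
      then show ?thesis
        unfolding X_def Y_def by simp
    qed
    also have "\<dots> = V p - f p"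
      by (simp add: V_def)
    finally show ?thesis
      by (simp add: const(4)[of p])
  qed
  ultimately show ?thesis
    by blast
qed

end

theorem theorem6:
  fixes \<mu> r m :: real and S :: "(real^3) set"
  assumes "\<mu> > 1" and "r > 0"
    and "pseudospherical_helicoid \<mu> r S"
    and "m = inverse \<mu>"
  shows "real_analytic2 (f_tilde m r) \<and> global_parametrization (f_tilde m r) (uminus ` S)"
proof -
  interpret helicoid m r
    using assms(1,2,4) by unfold_locales (auto simp: inverse_less_1_iff)
  obtain f where f: "pseudospherical_map (helicoid_angle (inverse m) r) f" and S: "S = range f"
    using assms(3,4) unfolding pseudospherical_helicoid_def by auto
  obtain A b where A: "rotation_matrix A"
    and eq: "\<forall>p. A *v f_tilde m r (u_coord p, w * l_coord p / (2 * pi)) + b = - f p"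
    using reflected_f_tilde_congruent[OF f] by blast
  have "(\<lambda>x. A *v x + b) ` range (f_tilde m r) = uminus ` S"
    unfolding range_f_tilde S image_image by (intro image_cong refl) (use eq in blast)
  moreover have "rigid_motion (\<lambda>x. A *v x + b)"
    using A unfolding rigid_motion_def by blast
  ultimately have "global_parametrization (f_tilde m r) (uminus ` S)"
    unfolding global_parametrization_def same_surface_def by blast
  then show ?thesis
    using real_analytic2_f_tilde by blast
qed

end
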